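(* Let $X$ be a Tychonoff space, $A(X)\in\sum(X)$, and $p,q\in\beta X\setminus\upsilon_A(X)$. Let $\mathfrak{F}$ be a proper copy of $A^{\nu}(X)/M_{A^{\nu}}^{p}$ in itself and $\mathfrak{F}'$ a proper copy of $A^{\nu}(X)/M_{A^{\nu}}^{q}$ in itself. Then the two rings $B_p^{\mathfrak{F}}(X)$ and $B_q^{\mathfrak{F}'}(X)$ are isomorphic only if there is a homeomorphism $h$ from $\beta X$ onto $\beta X$ with $h(p)=q$ which induces an isomorphism from $\mathfrak{F}$ onto $\mathfrak{F}'$.
   Context: For a Tychonoff (completely regular Hausdorff) space $X$, $C(X)$ is the ring of real-valued continuous functions on $X$ and $C^*(X)$ its subring of bounded functions. An intermediate ring is a subring (subalgebra) $A(X)$ with $C^*(X)\subseteq A(X)\subseteq C(X)$; $\sum(X)$ is the set of all intermediate rings. $\beta X$ is the Stone-Čech compactification. For $f\in A(X)$ let $\mathcal{Z}_A(f)$ be the set of all zero-sets $E$ of $X$ for which there is $g\in A(X)$ with $f(x)g(x)=1$ for all $x\in X\setminus E$; for $p\in\beta X$, $M_A^p=\{f\in A(X): p\in \mathrm{cl}_{\beta X}E \text{ for all } E\in\mathcal{Z}_A(f)\}$ (these are exactly the maximal ideals of $A(X)$). Put $\upsilon_A(X)=\{p\in\beta X: A(X)/M_A^p\cong\mathbb{R}\}$. For $f\in C(X)$, $f^*:\beta X\to\mathbb{R}^*=\mathbb{R}\cup\{\infty\}$ is the unique continuous extension of $f$ to a map into the one-point compactification of $\mathbb{R}$. $A^{\nu}(X)=\{f\in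 C(X): f^*(\upsilon_A(X))\subseteq\mathbb{R}\}$; this is an intermediate ring with $\upsilon_{A^{\nu}}(X)=\upsilon_A(X)$. For $p\in\beta X\setminus\upsilon_A(X)$ let $\theta_p:A^{\nu}(X)\to A^{\nu}(X)/M_{A^{\nu}}^{p}$ be the quotient map. A proper copy of the field $A^{\nu}(X)/M_{A^{\nu}}^{p}$ in itself is a proper subfield isomorphic to the whole field; for such a subfield $\mathfrak{F}$, $B_p^{\mathfrak{F}}(X)=\theta_p^{-1}(\mathfrak{F})$. A homeomorphism $h$ of $\beta X$ induces an isomorphism from $\mathfrak{F}$ onto $\mathfrak{F}'$ if the rule $\theta_p(f)\mapsto\theta_q\big((f^*\circ h^{-1})|_X\big)$, $f\in B_p^{\mathfrak{F}}(X)$, is a well-defined field isomorphism of $\mathfrak{F}$ onto $\mathfrak{F}'$ (in particular each $(f^*\circ h^{-1})|_X$ is real-valued and lies in $B_q^{\mathfrak{F}'}(X)$). *)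

theory Defs
  imports "HOL-Analysis.Analysis" "HOL-Algebra.QuotRing" "HOL-Algebra.Subrings"
begin

section \<open>Rings of continuous functions\<close>

definition tychonoff_space :: "'a topology \<Rightarrow> bool" where
  "tychonoff_space X \<longleftrightarrow> completely_regular_space X \<and> Hausdorff_space X"

text \<open>Functions on \<^term>\<open>X\<close> are represented by their extensional versions, i.e. with the value
  \<^term>\<open>undefined\<close> off \<^term>\<open>topspace X\<close>, so that equality of functions is equality on the space.\<close>

definition cont_funs :: "'a topology \<Rightarrow> ('a \<Rightarrow> real) set" where
  "cont_funs X = {f \<in> extensional (topspace X). continuous_map X euclideanreal f}"

definition bdd_cont_funs :: "'a topology \<Rightarrow> ('a \<Rightarrow> real) set" where
  "bdd_cont_funs X = {f \<in> cont_funs X. bounded (f ` topspace X)}"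

text \<open>The set \<^term>\<open>A\<close> of functions with pointwise operations; \<^term>\<open>fun_ring X (cont_funs X)\<close>
  is the ring $C(X)$.\<close>

definition fun_ring :: "'a topology \<Rightarrow> ('a \<Rightarrow> real) set \<Rightarrow> ('a \<Rightarrow> real) ring" where
  "fun_ring X A =
     \<lparr>carrier = A,
      mult = (\<lambda>f g. \<lambda>x\<in>topspace X. f x * g x),
      one = (\<lambda>x\<in>topspace X. 1),
      zero = (\<lambda>x\<in>topspace X. 0),
      add = (\<lambda>f g. \<lambda>x\<in>topspace X. f x + g x)\<rparr>"

text \<open>Closure under real scalars need not be required separately: the constant functions
  are bounded.\<close>

definition intermediate_ring :: "'a topology \<Rightarrow> ('a \<Rightarrow> real) set \<Rightarrow> bool" where
  "intermediate_ring X A \<longleftrightarrow>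
     subring A (fun_ring X (cont_funs X)) \<and> bdd_cont_funs X \<subseteq> A \<and> A \<subseteq> cont_funs X"

definition real_ring :: "real ring" where
  "real_ring = \<lparr>carrier = UNIV, mult = (*), one = 1, zero = 0, add = (+)\<rparr>"


section \<open>The Stone--\v{C}ech compactification\<close>

text \<open>The closure of the image of the space under evaluation in the product of real lines indexed
  by the bounded continuous functions.\<close>

definition sc_embed :: "'a topology \<Rightarrow> 'a \<Rightarrow> (('a \<Rightarrow> real) \<Rightarrow> real)" where
  "sc_embed X x = (\<lambda>f\<in>bdd_cont_funs X. f x)"

definition stone_cech :: "'a topology \<Rightarrow> (('a \<Rightarrow> real) \<Rightarrow> real) topology" where
  "stone_cech X =
     (let P = product_topology (\<lambda>_. euclideanreal) (bdd_cont_funs X)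
      in subtopology P (P closure_of (sc_embed X ` topspace X)))"

text \<open>The extension $f^*$ of $f$ to a map into the one-point compactification of the real line,
  in which \<^term>\<open>None\<close> is the point at infinity. It exists for every continuous $f$ on a Tychonoff
  space, because the one-point compactification is compact Hausdorff, and is unique because the
  image of the space is dense.\<close>

definition sc_ext :: "'a topology \<Rightarrow> ('a \<Rightarrow> real) \<Rightarrow> (('a \<Rightarrow> real) \<Rightarrow> real) \<Rightarrow> real option" where
  "sc_ext X f =
     (THE F. F \<in> extensional (topspace (stone_cech X)) \<and>
             continuous_map (stone_cech X) (Alexandroff_compactification euclideanreal) F \<and>
             (\<forall>x\<in>topspace X. F (sc_embed X x) = Some (f x)))"


section \<open>Maximal ideals of intermediate rings\<close>

definition zero_set :: "'a topology \<Rightarrow> 'a set \<Rightarrow> bool" where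
  "zero_set X E \<longleftrightarrow> (\<exists>f\<in>cont_funs X. E = {x \<in> topspace X. f x = 0})"

definition zsets :: "'a topology \<Rightarrow> ('a \<Rightarrow> real) set \<Rightarrow> ('a \<Rightarrow> real) \<Rightarrow> 'a set set" where
  "zsets X A f =
     {E. zero_set X E \<and> (\<exists>g\<in>A. \<forall>x\<in>topspace X - E. f x * g x = 1)}"

definition max_ideal ::
    "'a topology \<Rightarrow> ('a \<Rightarrow> real) set \<Rightarrow> (('a \<Rightarrow> real) \<Rightarrow> real) \<Rightarrow> ('a \<Rightarrow> real) set" where
  "max_ideal X A p =
     {f \<in> A. \<forall>E\<in>zsets X A f. p \<in> stone_cech X closure_of (sc_embed X ` E)}"

definition residue_field ::
    "'a topology \<Rightarrow> ('a \<Rightarrow> real) set \<Rightarrow> (('a \<Rightarrow> real) \<Rightarrow> real) \<Rightarrow> ('a \<Rightarrow> real) set ring" where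
  "residue_field X A p = fun_ring X A Quot max_ideal X A p"

text \<open>$\upsilon_A(X)$\<close>

definition real_points ::
    "'a topology \<Rightarrow> ('a \<Rightarrow> real) set \<Rightarrow> (('a \<Rightarrow> real) \<Rightarrow> real) set" where
  "real_points X A = {p \<in> topspace (stone_cech X). residue_field X A p \<simeq> real_ring}"

text \<open>$A^\nu(X)$\<close>

definition nu_ring :: "'a topology \<Rightarrow> ('a \<Rightarrow> real) set \<Rightarrow> ('a \<Rightarrow> real) set" where
  "nu_ring X A = {f \<in> cont_funs X. sc_ext X f ` real_points X A \<subseteq> range Some}"


section \<open>Proper copies of residue fields and the rings they determine\<close>

text \<open>\<open>theta X A p\<close> is the quotient map $A^\nu(X) \to A^\nu(X)/M_{A^\nu}^p$, and
  \<open>B_ring X A p F\<close> is $B_p^F(X)$.\<close>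

definition theta ::
    "'a topology \<Rightarrow> ('a \<Rightarrow> real) set \<Rightarrow> (('a \<Rightarrow> real) \<Rightarrow> real) \<Rightarrow> ('a \<Rightarrow> real) \<Rightarrow> ('a \<Rightarrow> real) set"
  where
  "theta X A p f =
     max_ideal X (nu_ring X A) p +>\<^bsub>fun_ring X (nu_ring X A)\<^esub> f"

definition proper_copy :: "'k set \<Rightarrow> 'k ring \<Rightarrow> bool" where
  "proper_copy F K \<longleftrightarrow> subfield F K \<and> F \<noteq> carrier K \<and> K\<lparr>carrier := F\<rparr> \<simeq> K"

definition B_ring ::
    "'a topology \<Rightarrow> ('a \<Rightarrow> real) set \<Rightarrow> (('a \<Rightarrow> real) \<Rightarrow> real) \<Rightarrow> ('a \<Rightarrow> real) set set \<Rightarrow>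
     ('a \<Rightarrow> real) set" where
  "B_ring X A p F = {f \<in> nu_ring X A. theta X A p f \<in> F}"

text \<open>For \<open>k\<close> the inverse of a self-homeomorphism $h$ of the Stone--\v{C}ech compactification,
  \<open>transport X k f\<close> is $(f^* \circ h^{-1})|_X$. It is meaningful only if \<open>real_transport X k f\<close>
  holds, i.e. if that function is real-valued.\<close>

definition real_transport ::
    "'a topology \<Rightarrow> ((('a \<Rightarrow> real) \<Rightarrow> real) \<Rightarrow> (('a \<Rightarrow> real) \<Rightarrow> real)) \<Rightarrow> ('a \<Rightarrow> real) \<Rightarrow> bool" where
  "real_transport X k f \<longleftrightarrow> (\<forall>x\<in>topspace X. sc_ext X f (k (sc_embed X x)) \<in> range Some)"

definition transport ::
    "'a topology \<Rightarrow> ((('a \<Rightarrow> real) \<Rightarrow> real) \<Rightarrow> (('a \<Rightarrow> real) \<Rightarrow> real)) \<Rightarrow> ('a \<Rightarrow> real) \<Rightarrow>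
     ('a \<Rightarrow> real)" where
  "transport X k f = (\<lambda>x\<in>topspace X. the (sc_ext X f (k (sc_embed X x))))"

text \<open>Since \<open>F\<close> consists of the classes \<open>theta X A p f\<close> with \<open>f\<close> in \<open>B_ring X A p F\<close>, the
  existence of \<open>\<psi>\<close> says that the rule
  $\theta_p(f) \mapsto \theta_q((f^* \circ h^{-1})|_X)$ is well defined and an isomorphism.\<close>

definition induces_iso ::
    "'a topology \<Rightarrow> ('a \<Rightarrow> real) set \<Rightarrow> (('a \<Rightarrow> real) \<Rightarrow> real) \<Rightarrow> (('a \<Rightarrow> real) \<Rightarrow> real) \<Rightarrow>
     ('a \<Rightarrow> real) set set \<Rightarrow> ('a \<Rightarrow> real) set set \<Rightarrow>
     ((('a \<Rightarrow> real) \<Rightarrow> real) \<Rightarrow> (('a \<Rightarrow> real) \<Rightarrow> real)) \<Rightarrow> bool" where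
  "induces_iso X A p q F F' h \<longleftrightarrow>
     (let k = inv_into (topspace (stone_cech X)) h in
      (\<forall>f\<in>B_ring X A p F. real_transport X k f \<and> transport X k f \<in> B_ring X A q F') \<and>
      (\<exists>\<psi>\<in>ring_iso ((residue_field X (nu_ring X A) p)\<lparr>carrier := F\<rparr>)
                   ((residue_field X (nu_ring X A) q)\<lparr>carrier := F'\<rparr>).
         \<forall>f\<in>B_ring X A p F. \<psi> (theta X A p f) = theta X A q (transport X k f)))"

end

theory Submission
  imports Defs
begin

text \<open>A point of $\beta X$ is a limit of point evaluations, hence a unital ring homomorphism from
  $C^*(X)$ to the reals, and all such homomorphisms arise in this way (\<open>stone_cech_binary\<close>,
  \<open>character_in_stone_cech\<close>). This turns the topology into algebra. The equation $f^*(p) = a$ means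
  that $p(wf) = p(w)a$ for some bounded $w$ with $wf$ bounded and $p(w) \neq 0$; the ideal $M_A^p$
  consists of the $f$ with $(fg)^*(p) = 0$ for all $g \in A(X)$ (\<open>max_ideal_iff\<close>); and, the field of
  real numbers having no endomorphism but the identity, $p$ lies in $\upsilon_A(X)$ exactly if
  $f^*(p)$ is finite for all $f \in A(X)$ (\<open>residue_field_real_iff\<close>).

  Write $N$ for $A^\nu(X)$, $M_p$ for its maximal ideal at $p$, and $B$, $B'$ for the two rings
  $B_p^F(X)$ and $B_q^{F'}(X)$, and let $\varphi$ be an isomorphism from $B$ onto $B'$. The ideal $M_p$
  of $N$ is contained in $B$, is maximal there, and has no common zero in $\upsilon_A(X)$, because
  $p$ is not a real point. For an ideal without common zeros there, the linear maps into $N$ are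
  the multiplications by elements of $N$ (\<open>multiplier_exists\<close>). So the ring $N$ can be recovered from
  $B$ and $M_p$ as a ring of multipliers.

  The key step is that $\varphi(M_p) = M_q$ (\<open>image_max_ideal\<close>). If $\varphi(M_p)$ had a common zero
  $y \in \upsilon_A(X)$, evaluation at $y$ would embed $B/M_p \cong F$ into the reals; as $F$ is a copy of
  $N/M_p$, this would make $p$ a real point (\<open>image_free\<close>). Otherwise an element of $N$ outside $B$,
  which exists because $F$ is proper, acts on $\varphi(M_p)$ as multiplication by some $f' \in N$. If
  $\varphi(M_p) \neq M_q$, these two maximal ideals of $B'$ have sum $B'$, and since $f'$ maps both into
  $B'$ it lies in $B'$ and so comes from an element of $B$. This element acts on $M_p$ like the chosen
  one, hence is equal to it: a contradiction.

  Consequently $\varphi$ extends to an automorphism $\Phi$ of $N$, the ring of multipliers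
  (\<open>extension\<close>). By rigidity $\Phi$ fixes the constants, and by the existence of square roots it
  preserves boundedness; hence composition of characters with $\Phi^{-1}$ is a homeomorphism $h$ of $\beta X$.
  It sends $p$ to $q$ because the bounded elements of $M_q$ determine $q$, and
  $(f^* \circ h^{-1})|_X$ is $\Phi(f)$, which is $\varphi(f)$ for $f \in B$. As $\varphi$ maps $M_p$
  onto $M_q$, it induces the isomorphism between the two subfields (\<open>residue_iso_induced\<close>).\<close>

section \<open>Rigidity of the reals\<close>

text \<open>A ring endomorphism of the reals fixes the rationals and preserves order, because the nonnegative
  reals are the squares. This rigidity is what makes real residue fields visible: every unital
  ring homomorphism from an algebra containing the constants to the reals fixes the constants.\<close>

lemma real_endomorphism_id:
  fixes \<tau> :: "real \<Rightarrow> real"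
  assumes add: "\<And>x y. \<tau> (x + y) = \<tau> x + \<tau> y"
    and mult: "\<And>x y. \<tau> (x * y) = \<tau> x * \<tau> y" and one: "\<tau> 1 = 1"
  shows "\<tau> c = c"
proof -
  have zero: "\<tau> 0 = 0" using add[of 0 0] by simp
  have minus: "\<tau> (- x) = - \<tau> x" for x using add[of x "- x"] zero by simp
  have of_nat: "\<tau> (real n) = real n" for n
    by (induction n) (auto simp: zero add one)
  have of_int: "\<tau> (real_of_int z) = real_of_int z" for z
    by (cases z rule: int_cases2) (auto simp: of_nat minus)
  have rat: "\<tau> r = r" if "r \<in> \<rat>" for r
  proof -
    obtain a b where r: "r = real_of_int a / real_of_int b" and b: "b \<noteq> 0"
      using \<open>r \<in> \<rat>\<close> by (elim Rats_cases') auto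
    have "\<tau> r * real_of_int b = real_of_int a"
      using mult[of r "real_of_int b"] b by (simp add: of_int r)
    then show ?thesis using b by (simp add: r field_simps)
  qed
  have mono: "\<tau> x \<le> \<tau> y" if "x \<le> y" for x y
  proof -
    have "\<tau> (y - x) = \<tau> (sqrt (y - x)) * \<tau> (sqrt (y - x))"
      using that by (simp flip: mult)
    then have "\<tau> (y - x) \<ge> 0" by simp
    then show ?thesis using add[of x "y - x"] by simp
  qed
  show ?thesis
  proof (rule ccontr)
    assume "\<tau> c \<noteq> c"
    then consider "\<tau> c < c" | "c < \<tau> c" by linarith
    then show False
    proof cases
      case 1
      then obtain r where "r \<in> \<rat>" "\<tau> c < r" "r < c" using Rats_dense_in_real by blast
      then show False using mono[of r c] rat by simp
    next
      case 2
      then obtain r where "r \<in> \<rat>" "c < r" "r < \<tau> c" using Rats_dense_in_real by blast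
      then show False using mono[of c r] rat by simp
    qed
  qed
qed

section \<open>Continuous and bounded functions\<close>

lemma restrict_in_cont_funs:
  assumes "continuous_map X euclideanreal g"
  shows "(\<lambda>x\<in>topspace X. g x) \<in> cont_funs X"
  using continuous_map_eq[OF assms, of "\<lambda>x\<in>topspace X. g x"] by (simp add: cont_funs_def)

lemma cont_funs_continuous: "f \<in> cont_funs X \<Longrightarrow> continuous_map X euclideanreal f"
  by (simp add: cont_funs_def)

lemma cont_funs_restrict: "f \<in> cont_funs X \<Longrightarrow> (\<lambda>x\<in>topspace X. f x) = f"
  by (simp add: cont_funs_def extensional_restrict)

lemma cont_funs_eqI:
  "\<lbrakk>f \<in> cont_funs X; g \<in> cont_funs X; \<And>x. x \<in> topspace X \<Longrightarrow> f x = g x\<rbrakk> \<Longrightarrow> f = g"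
  unfolding cont_funs_def by (blast intro: extensionalityI)

lemma bdd_cont_funs_subset: "bdd_cont_funs X \<subseteq> cont_funs X"
  by (auto simp: bdd_cont_funs_def)

lemma bdd_cont_funs_continuous: "f \<in> bdd_cont_funs X \<Longrightarrow> continuous_map X euclideanreal f"
  by (simp add: bdd_cont_funs_def cont_funs_def)

lemma restrict_in_bdd_cont_funs:
  assumes "continuous_map X euclideanreal g" and "\<And>x. x \<in> topspace X \<Longrightarrow> \<bar>g x\<bar> \<le> c"
  shows "(\<lambda>x\<in>topspace X. g x) \<in> bdd_cont_funs X"
  using assms restrict_in_cont_funs[OF assms(1)]
  by (auto simp: bdd_cont_funs_def bounded_iff)

lemma bdd_cont_funs_bound:
  assumes "f \<in> bdd_cont_funs X"
  obtains c where "\<And>x. x \<in> topspace X \<Longrightarrow> \<bar>f x\<bar> \<le> c"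
  using assms by (auto simp: bdd_cont_funs_def bounded_iff)

lemma continuous_map_binary:
  fixes H :: "real \<Rightarrow> real \<Rightarrow> real"
  assumes "continuous_on UNIV (\<lambda>z. H (fst z) (snd z))"
    and "continuous_map X euclideanreal f" and "continuous_map X euclideanreal g"
  shows "continuous_map X euclideanreal (\<lambda>x. H (f x) (g x))"
proof -
  have "continuous_map X (prod_topology euclideanreal euclideanreal) (\<lambda>x. (f x, g x))"
    using assms(2,3) by (simp only: continuous_map_paired simp_thms)
  moreover have "continuous_map (prod_topology euclideanreal euclideanreal) euclideanreal
      (\<lambda>z. H (fst z) (snd z))"
    using assms(1) by simp
  ultimately have "continuous_map X euclideanreal ((\<lambda>z. H (fst z) (snd z)) \<circ> (\<lambda>x. (f x, g x)))"
    by (rule continuous_map_compose)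
  then show ?thesis by (simp add: o_def)
qed

lemma bdd_cont_funs_binary:
  fixes H :: "real \<Rightarrow> real \<Rightarrow> real"
  assumes H: "continuous_on UNIV (\<lambda>z. H (fst z) (snd z))"
    and f: "f \<in> bdd_cont_funs X" and g: "g \<in> bdd_cont_funs X"
  shows "(\<lambda>x\<in>topspace X. H (f x) (g x)) \<in> bdd_cont_funs X"
proof -
  obtain a where a: "\<And>x. x \<in> topspace X \<Longrightarrow> \<bar>f x\<bar> \<le> a" using bdd_cont_funs_bound[OF f] by blast
  obtain b where b: "\<And>x. x \<in> topspace X \<Longrightarrow> \<bar>g x\<bar> \<le> b" using bdd_cont_funs_bound[OF g] by blast
  have "compact ((\<lambda>z. H (fst z) (snd z)) ` ({-a..a} \<times> {-b..b}))"
    by (intro compact_continuous_image compact_Times continuous_on_subset[OF H]) auto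
  then have "bounded ((\<lambda>z. H (fst z) (snd z)) ` ({-a..a} \<times> {-b..b}))"
    by (rule compact_imp_bounded)
  then obtain c where c: "\<And>z. z \<in> {-a..a} \<times> {-b..b} \<Longrightarrow> \<bar>H (fst z) (snd z)\<bar> \<le> c"
    unfolding bounded_iff ball_simps real_norm_def by blast
  show ?thesis
  proof (rule restrict_in_bdd_cont_funs)
    show "continuous_map X euclideanreal (\<lambda>x. H (f x) (g x))"
      by (intro continuous_map_binary[OF H] bdd_cont_funs_continuous f g)
    show "\<bar>H (f x) (g x)\<bar> \<le> c" if "x \<in> topspace X" for x
    proof -
      have "(f x, g x) \<in> {-a..a} \<times> {-b..b}"
        using a[OF that] b[OF that] by (auto simp: abs_le_iff)
      from c[OF this] show ?thesis by simp
    qed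
  qed
qed

section \<open>Points of the Stone-Cech compactification as characters\<close>

lemma topspace_stone_cech:
  "topspace (stone_cech X) =
     product_topology (\<lambda>_. euclideanreal) (bdd_cont_funs X) closure_of (sc_embed X ` topspace X)"
  unfolding stone_cech_def Let_def topspace_subtopology
  by (rule Int_absorb1[OF closure_of_subset_topspace])

lemma stone_cech_eq:
  "stone_cech X =
     subtopology (product_topology (\<lambda>_. euclideanreal) (bdd_cont_funs X)) (topspace (stone_cech X))"
  unfolding topspace_stone_cech by (simp only: stone_cech_def Let_def)

lemma sc_embed_in_product:
  "sc_embed X ` topspace X \<subseteq> topspace (product_topology (\<lambda>_. euclideanreal) (bdd_cont_funs X))"
  by (auto simp: sc_embed_def)

lemma sc_embed_in_stone_cech: "x \<in> topspace X \<Longrightarrow> sc_embed X x \<in> topspace (stone_cech X)"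
  using closure_of_subset[OF sc_embed_in_product, of X] by (auto simp: topspace_stone_cech)

lemma sc_embed_apply: "f \<in> bdd_cont_funs X \<Longrightarrow> sc_embed X x f = f x"
  by (simp add: sc_embed_def)

lemma stone_cech_dense:
  "(stone_cech X) closure_of (sc_embed X ` topspace X) = topspace (stone_cech X)"
proof -
  let ?P = "product_topology (\<lambda>_. euclideanreal) (bdd_cont_funs X)"
  let ?E = "sc_embed X ` topspace X"
  have E: "topspace (stone_cech X) \<inter> ?E = ?E"
    by (intro Int_absorb1 image_subsetI sc_embed_in_stone_cech)
  have "stone_cech X closure_of ?E = subtopology ?P (topspace (stone_cech X)) closure_of ?E"
    by (rule arg_cong[OF stone_cech_eq])
  also have "\<dots> = topspace (stone_cech X) \<inter> ?P closure_of ?E"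
    unfolding closure_of_subtopology E ..
  also have "\<dots> = topspace (stone_cech X)"
    unfolding topspace_stone_cech by (rule Int_absorb)
  finally show ?thesis .
qed

lemma stone_cech_extensional: "p \<in> topspace (stone_cech X) \<Longrightarrow> p \<in> extensional (bdd_cont_funs X)"
  using closure_of_subset_topspace[of "product_topology (\<lambda>_. euclideanreal) (bdd_cont_funs X)"]
  by (force simp: topspace_stone_cech PiE_def)

lemma continuous_map_stone_cech_coordinate:
  "f \<in> bdd_cont_funs X \<Longrightarrow> continuous_map (stone_cech X) euclideanreal (\<lambda>r. r f)"
  by (subst stone_cech_eq)
    (auto intro: continuous_map_from_subtopology continuous_map_product_projection)

text \<open>Both sides are continuous in \<open>p\<close> and agree at the dense set of point evaluations. Taking sums and
  products for \<open>H\<close> shows that \<open>p\<close> is a ring homomorphism on the bounded functions; other choices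
  of \<open>H\<close> show that it commutes with absolute values, truncations and so on.\<close>

lemma stone_cech_binary:
  fixes H :: "real \<Rightarrow> real \<Rightarrow> real"
  assumes H: "continuous_on UNIV (\<lambda>z. H (fst z) (snd z))"
    and f: "f \<in> bdd_cont_funs X" and g: "g \<in> bdd_cont_funs X"
    and p: "p \<in> topspace (stone_cech X)"
  shows "p (\<lambda>x\<in>topspace X. H (f x) (g x)) = H (p f) (p g)"
proof -
  let ?h = "\<lambda>x\<in>topspace X. H (f x) (g x)"
  have h: "?h \<in> bdd_cont_funs X" by (rule bdd_cont_funs_binary[OF H f g])
  show ?thesis
  proof (rule forall_in_closure_of_eq[where X = "stone_cech X" and Y = euclideanreal
        and S = "sc_embed X ` topspace X" and x = p and f = "\<lambda>r. r ?h"
        and g = "\<lambda>r. H (r f) (r g)"])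
    show "p \<in> (stone_cech X) closure_of sc_embed X ` topspace X"
      using p by (simp add: stone_cech_dense)
    show "continuous_map (stone_cech X) euclideanreal (\<lambda>r. r ?h)"
      by (rule continuous_map_stone_cech_coordinate[OF h])
    show "continuous_map (stone_cech X) euclideanreal (\<lambda>r. H (r f) (r g))"
      by (intro continuous_map_binary[OF H] continuous_map_stone_cech_coordinate f g)
    show "r ?h = H (r f) (r g)" if "r \<in> sc_embed X ` topspace X" for r
      using that f g h by (auto simp: sc_embed_apply)
  qed simp
qed

lemma continuous_on_binary_ops:
  "continuous_on UNIV (\<lambda>z :: real \<times> real. fst z + snd z)"
  "continuous_on UNIV (\<lambda>z :: real \<times> real. fst z * snd z)"
  by (intro continuous_intros)+

lemmas bdd_add = bdd_cont_funs_binary[OF continuous_on_binary_ops(1)]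
lemmas bdd_mult = bdd_cont_funs_binary[OF continuous_on_binary_ops(2)]
lemmas stone_cech_add = stone_cech_binary[OF continuous_on_binary_ops(1)]
lemmas stone_cech_mult = stone_cech_binary[OF continuous_on_binary_ops(2)]

lemma bdd_const: "(\<lambda>x\<in>topspace X. c) \<in> bdd_cont_funs X"
  by (rule restrict_in_bdd_cont_funs[where c = "\<bar>c\<bar>"]) auto

lemma continuous_on_first_argument:
  assumes "continuous_on UNIV (H :: real \<Rightarrow> real)"
  shows "continuous_on UNIV (\<lambda>z :: real \<times> real. H (fst z))"
  using continuous_on_compose2[OF assms continuous_on_fst[OF continuous_on_id]] by simp

lemma bdd_comp:
  assumes "continuous_on UNIV H" and "f \<in> bdd_cont_funs X"
  shows "(\<lambda>x\<in>topspace X. H (f x)) \<in> bdd_cont_funs X"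
  by (rule bdd_cont_funs_binary[where H = "\<lambda>a b. H a" and g = f])
    (simp_all add: assms continuous_on_first_argument)

lemma stone_cech_comp:
  assumes "continuous_on UNIV H" and "f \<in> bdd_cont_funs X" and "p \<in> topspace (stone_cech X)"
  shows "p (\<lambda>x\<in>topspace X. H (f x)) = H (p f)"
  by (rule stone_cech_binary[where H = "\<lambda>a b. H a" and g = f])
    (simp_all add: assms continuous_on_first_argument)

lemma stone_cech_const:
  assumes "p \<in> topspace (stone_cech X)"
  shows "p (\<lambda>x\<in>topspace X. c) = c"
  by (rule stone_cech_comp[where H = "\<lambda>_. c", OF _ bdd_const assms]) simp

text \<open>Together with \<open>stone_cech_binary\<close> this identifies the points of the compactification with the
  unital ring homomorphisms from the bounded continuous functions to the reals. If no point
  evaluation were close to \<open>\<xi>\<close> on finitely many given functions, a sum of squares in the kernel of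
  \<open>\<xi>\<close> would be bounded away from zero, hence a unit.\<close>

lemma character_in_stone_cech:
  assumes ext: "\<xi> \<in> extensional (bdd_cont_funs X)"
    and add: "\<And>f g. \<lbrakk>f \<in> bdd_cont_funs X; g \<in> bdd_cont_funs X\<rbrakk>
      \<Longrightarrow> \<xi> (\<lambda>x\<in>topspace X. f x + g x) = \<xi> f + \<xi> g"
    and mult: "\<And>f g. \<lbrakk>f \<in> bdd_cont_funs X; g \<in> bdd_cont_funs X\<rbrakk>
      \<Longrightarrow> \<xi> (\<lambda>x\<in>topspace X. f x * g x) = \<xi> f * \<xi> g"
    and one: "\<xi> (\<lambda>x\<in>topspace X. 1) = 1"
  shows "\<xi> \<in> topspace (stone_cech X)"
proof -
  let ?BC = "bdd_cont_funs X"
  let ?P = "product_topology (\<lambda>_. euclideanreal) ?BC"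
  have const: "\<xi> (\<lambda>x\<in>topspace X. c) = c" for c
  proof (rule real_endomorphism_id[where \<tau> = "\<lambda>c. \<xi> (\<lambda>x\<in>topspace X. c)"])
    show "\<xi> (\<lambda>x\<in>topspace X. a + b) = \<xi> (\<lambda>x\<in>topspace X. a) + \<xi> (\<lambda>x\<in>topspace X. b)" for a b
      using add[OF bdd_const[where c=a] bdd_const[where c=b]] by (simp cong: restrict_cong)
    show "\<xi> (\<lambda>x\<in>topspace X. a * b) = \<xi> (\<lambda>x\<in>topspace X. a) * \<xi> (\<lambda>x\<in>topspace X. b)" for a b
      using mult[OF bdd_const[where c=a] bdd_const[where c=b]] by (simp cong: restrict_cong)
  qed (rule one)
  \<comment> \<open>An element of the kernel that is small only where finitely many prescribed functions are
    close to their values under \<open>\<xi>\<close>: a finite sum of squares, built by induction.\<close>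
  have kernel: "\<exists>c\<in>?BC. \<xi> c = 0 \<and> (\<forall>x\<in>topspace X. 0 \<le> c x) \<and>
      (\<forall>x\<in>topspace X. c x < 1 \<longrightarrow> (\<forall>f\<in>I. f x \<in> U f))"
    if "finite I" "I \<subseteq> ?BC" "\<And>f. f \<in> I \<Longrightarrow> open (U f) \<and> \<xi> f \<in> U f"
    for I and U :: "('a \<Rightarrow> real) \<Rightarrow> real set"
    using that
  proof (induction I)
    case empty
    show ?case
    proof (intro bexI conjI)
      show "\<xi> (\<lambda>x\<in>topspace X. 0) = 0" by (rule const)
    qed (simp_all only: bdd_const, auto)
  next
    case (insert f I)
    then obtain c where c: "c \<in> ?BC" "\<xi> c = 0" "\<And>x. x \<in> topspace X \<Longrightarrow> 0 \<le> c x"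
      "\<And>x g. \<lbrakk>x \<in> topspace X; c x < 1; g \<in> I\<rbrakk> \<Longrightarrow> g x \<in> U g"
      by auto
    from insert.prems obtain e where e: "e > 0" "ball (\<xi> f) e \<subseteq> U f"
      using open_contains_ball_eq[of "U f" "\<xi> f"] by blast
    have f: "f \<in> ?BC" using insert.prems by auto
    define d where "d = (\<lambda>x\<in>topspace X. f x + (\<lambda>x\<in>topspace X. - \<xi> f) x)"
    define d' where "d' = (\<lambda>x\<in>topspace X. d x * (\<lambda>x\<in>topspace X. 1 / e) x)"
    define s where "s = (\<lambda>x\<in>topspace X. d' x * d' x)"
    have d: "d \<in> ?BC" "\<xi> d = 0"
      unfolding d_def add[OF f bdd_const] const by (rule bdd_add[OF f bdd_const]) simp
    have d': "d' \<in> ?BC" "\<xi> d' = 0"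
      unfolding d'_def mult[OF d(1) bdd_const] d(2) by (rule bdd_mult[OF d(1) bdd_const]) simp
    have s: "s \<in> ?BC" "\<xi> s = 0"
      unfolding s_def mult[OF d'(1) d'(1)] d'(2) by (rule bdd_mult[OF d'(1) d'(1)]) simp
    have sx: "s x = ((f x - \<xi> f) / e)\<^sup>2" if "x \<in> topspace X" for x
      using that by (simp add: s_def d'_def d_def power2_eq_square)
    show ?case
    proof (intro bexI conjI ballI impI)
      show "(\<lambda>x\<in>topspace X. c x + s x) \<in> ?BC"
        by (rule bdd_add[OF c(1) s(1)])
      show "\<xi> (\<lambda>x\<in>topspace X. c x + s x) = 0"
        by (simp only: add[OF c(1) s(1)] c(2) s(2) add_0)
      show "0 \<le> (\<lambda>x\<in>topspace X. c x + s x) x" if "x \<in> topspace X" for x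
        using that c sx by simp
      fix x g assume x: "x \<in> topspace X" and lt: "(\<lambda>x\<in>topspace X. c x + s x) x < 1"
        and g: "g \<in> insert f I"
      have le: "c x + s x < 1" "0 \<le> c x" "0 \<le> s x" using x lt c sx by auto
      show "g x \<in> U g"
      proof (cases "g = f")
        case True
        have "((f x - \<xi> f) / e)\<^sup>2 < 1" using le sx[OF x] by linarith
        then have "\<bar>(f x - \<xi> f) / e\<bar> < 1" by (simp only: abs_square_less_1)
        then have "\<bar>f x - \<xi> f\<bar> < e" using e(1) by (simp add: abs_divide)
        then have "f x \<in> ball (\<xi> f) e" by (simp add: dist_real_def abs_minus_commute)
        then show ?thesis using e True by auto
      qed (use le c x g in auto)
    qed
  qed
  have "\<exists>y. y \<in> sc_embed X ` topspace X \<and> y \<in> V" if V: "\<xi> \<in> V" "openin ?P V" for V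
  proof -
    obtain U where U: "\<xi> \<in> (\<Pi>\<^sub>E f\<in>?BC. U f)" "\<And>f. openin euclideanreal (U f)"
      "finite {f. U f \<noteq> topspace euclideanreal}" "(\<Pi>\<^sub>E f\<in>?BC. U f) \<subseteq> V"
      using product_topology_open_contains_basis[OF V(2,1)] by auto
    define I where "I = {f \<in> ?BC. U f \<noteq> UNIV}"
    have "finite I" by (rule finite_subset[OF _ U(3)]) (auto simp: I_def)
    then obtain c where c: "c \<in> ?BC" "\<xi> c = 0" "\<And>x. x \<in> topspace X \<Longrightarrow> 0 \<le> c x"
      "\<And>x f. \<lbrakk>x \<in> topspace X; c x < 1; f \<in> I\<rbrakk> \<Longrightarrow> f x \<in> U f"
    proof -
      have "\<exists>c\<in>?BC. \<xi> c = 0 \<and> (\<forall>x\<in>topspace X. 0 \<le> c x) \<and>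
          (\<forall>x\<in>topspace X. c x < 1 \<longrightarrow> (\<forall>f\<in>I. f x \<in> U f))"
      proof (rule kernel[OF \<open>finite I\<close>])
        show "open (U f) \<and> \<xi> f \<in> U f" if "f \<in> I" for f
          using U(2)[of f] PiE_mem[OF U(1), of f] that by (simp add: I_def)
      qed (auto simp: I_def)
      then show thesis using that by blast
    qed
    \<comment> \<open>A kernel element that is at least 1 everywhere would be a unit.\<close>
    have "\<exists>x\<in>topspace X. c x < 1"
    proof (rule ccontr)
      assume "\<not> ?thesis"
      then have big: "1 \<le> c x" if "x \<in> topspace X" for x using that by (meson not_less)
      let ?i = "\<lambda>x\<in>topspace X. 1 / c x"
      have i: "?i \<in> ?BC"
      proof (rule restrict_in_bdd_cont_funs[where c = 1])
        show "continuous_map X euclideanreal (\<lambda>x. 1 / c x)"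
        proof (rule continuous_map_real_divide)
          show "c x \<noteq> 0" if "x \<in> topspace X" for x using big[OF that] by simp
        qed (simp_all add: bdd_cont_funs_continuous c(1))
        show "\<bar>1 / c x\<bar> \<le> 1" if "x \<in> topspace X" for x using big[OF that] by simp
      qed
      have "(\<lambda>x\<in>topspace X. c x * ?i x) = (\<lambda>x\<in>topspace X. 1)"
      proof (rule restrict_ext)
        show "c x * ?i x = 1" if "x \<in> topspace X" for x using big[OF that] that by simp
      qed
      then show False using mult[OF c(1) i] one c(2) by simp
    qed
    then obtain x where x: "x \<in> topspace X" "c x < 1" by blast
    have "sc_embed X x \<in> (\<Pi>\<^sub>E f\<in>?BC. U f)"
    proof (rule PiE_I)
      show "sc_embed X x f \<in> U f" if "f \<in> ?BC" for f
        using that c(4)[OF x, of f] by (cases "f \<in> I") (auto simp: sc_embed_apply I_def)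
    qed (simp add: sc_embed_def)
    then show ?thesis using U(4) x by blast
  qed
  then show ?thesis
    using ext unfolding topspace_stone_cech in_closure_of by (simp add: PiE_def)
qed

section \<open>Finite values of the extension of a function\<close>

text \<open>This is the algebraic form of $f^*(p) = a$. Since \<open>p\<close> is a character of the bounded functions only,
  \<open>f\<close> is multiplied by a bounded \<open>w\<close> that makes it bounded and does not vanish at \<open>p\<close>, as in a
  localization. The equivalence with the topological definition is \<open>sc_ext_eq_Some_iff\<close>.\<close>

definition finite_value ::
    "'a topology \<Rightarrow> (('a \<Rightarrow> real) \<Rightarrow> real) \<Rightarrow> ('a \<Rightarrow> real) \<Rightarrow> real \<Rightarrow> bool" where
  "finite_value X p f a \<longleftrightarrow>
     (\<exists>w\<in>bdd_cont_funs X. p w \<noteq> 0 \<and> (\<lambda>x\<in>topspace X. w x * f x) \<in> bdd_cont_funs X \<and>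
        p (\<lambda>x\<in>topspace X. w x * f x) = p w * a)"

lemma finite_valueE:
  assumes "finite_value X p f a"
  obtains w u where "w \<in> bdd_cont_funs X" "p w \<noteq> 0" "u \<in> bdd_cont_funs X" "p u = p w * a"
    "\<forall>x\<in>topspace X. u x = w x * f x"
proof -
  from assms obtain w where w: "w \<in> bdd_cont_funs X" "p w \<noteq> 0"
    "(\<lambda>x\<in>topspace X. w x * f x) \<in> bdd_cont_funs X"
    "p (\<lambda>x\<in>topspace X. w x * f x) = p w * a"
    unfolding finite_value_def by blast
  show thesis by (rule that[OF w]) simp
qed

lemma finite_valueI:
  assumes "w \<in> bdd_cont_funs X" "p w \<noteq> 0" "u \<in> bdd_cont_funs X" "p u = p w * a"
    "\<forall>x\<in>topspace X. u x = w x * f x"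
  shows "finite_value X p f a"
proof -
  have "(\<lambda>x\<in>topspace X. w x * f x) = (\<lambda>x\<in>topspace X. u x)"
    by (rule restrict_ext) (simp add: assms(5))
  also have "\<dots> = u"
    using assms(3) bdd_cont_funs_subset cont_funs_restrict by blast
  finally show ?thesis using assms unfolding finite_value_def by auto
qed

text \<open>With denominators \<open>w\<close> and \<open>v\<close>, both values are read off from the common multiple \<open>v w f\<close>.\<close>

lemma finite_value_unique:
  assumes p: "p \<in> topspace (stone_cech X)" and "finite_value X p f a" and "finite_value X p f b"
  shows "a = b"
proof -
  obtain w u where w: "w \<in> bdd_cont_funs X" "p w \<noteq> 0" "u \<in> bdd_cont_funs X" "p u = p w * a"
    "\<forall>x\<in>topspace X. u x = w x * f x" by (rule finite_valueE[OF assms(2)])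
  obtain v t where v: "v \<in> bdd_cont_funs X" "p v \<noteq> 0" "t \<in> bdd_cont_funs X" "p t = p v * b"
    "\<forall>x\<in>topspace X. t x = v x * f x" by (rule finite_valueE[OF assms(3)])
  have "(\<lambda>x\<in>topspace X. v x * u x) = (\<lambda>x\<in>topspace X. w x * t x)"
    by (rule restrict_ext) (simp add: w(5) v(5))
  then have "p v * p u = p w * p t"
    using stone_cech_mult[OF v(1) w(3) p] stone_cech_mult[OF w(1) v(3) p] by simp
  then show ?thesis using w v by simp
qed

lemma finite_value_cong:
  "\<lbrakk>\<And>x. x \<in> topspace X \<Longrightarrow> f x = g x\<rbrakk> \<Longrightarrow> finite_value X p f a = finite_value X p g a"
  unfolding finite_value_def by (simp cong: restrict_cong)

lemma finite_value_add:
  assumes p: "p \<in> topspace (stone_cech X)" and "finite_value X p f a" and "finite_value X p g b"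
  shows "finite_value X p (\<lambda>x\<in>topspace X. f x + g x) (a + b)"
proof -
  obtain w u where w: "w \<in> bdd_cont_funs X" "p w \<noteq> 0" "u \<in> bdd_cont_funs X" "p u = p w * a"
    "\<forall>x\<in>topspace X. u x = w x * f x" by (rule finite_valueE[OF assms(2)])
  obtain v t where v: "v \<in> bdd_cont_funs X" "p v \<noteq> 0" "t \<in> bdd_cont_funs X" "p t = p v * b"
    "\<forall>x\<in>topspace X. t x = v x * g x" by (rule finite_valueE[OF assms(3)])
  note vu = bdd_mult[OF v(1) w(3)] and wt = bdd_mult[OF w(1) v(3)]
  show ?thesis
  proof (rule finite_valueI)
    show "(\<lambda>x\<in>topspace X. w x * v x) \<in> bdd_cont_funs X" by (rule bdd_mult[OF w(1) v(1)])
    show "p (\<lambda>x\<in>topspace X. w x * v x) \<noteq> 0" using stone_cech_mult[OF w(1) v(1) p] w v by simp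
    show "(\<lambda>x\<in>topspace X. (\<lambda>x\<in>topspace X. v x * u x) x + (\<lambda>x\<in>topspace X. w x * t x) x)
        \<in> bdd_cont_funs X"
      by (rule bdd_add[OF vu wt])
    show "p (\<lambda>x\<in>topspace X. (\<lambda>x\<in>topspace X. v x * u x) x + (\<lambda>x\<in>topspace X. w x * t x) x)
        = p (\<lambda>x\<in>topspace X. w x * v x) * (a + b)"
      unfolding stone_cech_add[OF vu wt p] stone_cech_mult[OF v(1) w(3) p]
        stone_cech_mult[OF w(1) v(3) p] stone_cech_mult[OF w(1) v(1) p] w(4) v(4)
      by (simp add: algebra_simps)
  qed (simp add: w(5) v(5) algebra_simps)
qed

lemma finite_value_mult:
  assumes p: "p \<in> topspace (stone_cech X)" and "finite_value X p f a" and "finite_value X p g b"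
  shows "finite_value X p (\<lambda>x\<in>topspace X. f x * g x) (a * b)"
proof -
  obtain w u where w: "w \<in> bdd_cont_funs X" "p w \<noteq> 0" "u \<in> bdd_cont_funs X" "p u = p w * a"
    "\<forall>x\<in>topspace X. u x = w x * f x" by (rule finite_valueE[OF assms(2)])
  obtain v t where v: "v \<in> bdd_cont_funs X" "p v \<noteq> 0" "t \<in> bdd_cont_funs X" "p t = p v * b"
    "\<forall>x\<in>topspace X. t x = v x * g x" by (rule finite_valueE[OF assms(3)])
  show ?thesis
  proof (rule finite_valueI)
    show "(\<lambda>x\<in>topspace X. w x * v x) \<in> bdd_cont_funs X" by (rule bdd_mult[OF w(1) v(1)])
    show "p (\<lambda>x\<in>topspace X. w x * v x) \<noteq> 0" using stone_cech_mult[OF w(1) v(1) p] w v by simp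
    show "(\<lambda>x\<in>topspace X. u x * t x) \<in> bdd_cont_funs X" by (rule bdd_mult[OF w(3) v(3)])
    show "p (\<lambda>x\<in>topspace X. u x * t x) = p (\<lambda>x\<in>topspace X. w x * v x) * (a * b)"
      unfolding stone_cech_mult[OF w(3) v(3) p] stone_cech_mult[OF w(1) v(1) p] w(4) v(4)
      by (simp add: algebra_simps)
  qed (simp add: w(5) v(5) algebra_simps)
qed

lemma finite_value_bdd:
  assumes p: "p \<in> topspace (stone_cech X)" and f: "f \<in> bdd_cont_funs X"
  shows "finite_value X p f (p f)"
  by (rule finite_valueI[where w = "\<lambda>x\<in>topspace X. 1" and u = f])
    (simp_all only: bdd_const f stone_cech_const[OF p], simp_all)

lemma finite_value_bdd_eq:
  "\<lbrakk>p \<in> topspace (stone_cech X); f \<in> bdd_cont_funs X; finite_value X p f a\<rbrakk> \<Longrightarrow> a = p f"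
  using finite_value_unique finite_value_bdd by blast

lemma finite_value_const:
  assumes p: "p \<in> topspace (stone_cech X)"
  shows "finite_value X p (\<lambda>x\<in>topspace X. c) c"
  using finite_value_bdd[OF p bdd_const, of c] unfolding stone_cech_const[OF p] .

text \<open>The bounded functions $1/(1+f^2)$ and $f/(1+f^2)$ form a universal fraction for \<open>f\<close>: the pair is
  the image of \<open>f\<close> on a circle, which is the one-point compactification of the line, and the point at
  infinity is where the first function vanishes.\<close>

definition damp :: "'a topology \<Rightarrow> ('a \<Rightarrow> real) \<Rightarrow> 'a \<Rightarrow> real" where
  "damp X f = (\<lambda>x\<in>topspace X. 1 / (1 + (f x)\<^sup>2))"

definition damped :: "'a topology \<Rightarrow> ('a \<Rightarrow> real) \<Rightarrow> 'a \<Rightarrow> real" where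
  "damped X f = (\<lambda>x\<in>topspace X. f x / (1 + (f x)\<^sup>2))"

lemma one_plus_square_pos: "0 < 1 + (a :: real)\<^sup>2"
  by (simp add: add_pos_nonneg)

lemma one_plus_square_neq_0: "1 + (a :: real)\<^sup>2 \<noteq> 0"
  using one_plus_square_pos[of a] by linarith

lemma quadratic_root:
  fixes a w :: real
  assumes "a\<^sup>2 * w\<^sup>2 + w\<^sup>2 = w" and "w \<noteq> 0"
  shows "w = 1 / (1 + a\<^sup>2)"
proof -
  have "w * (w * (1 + a\<^sup>2)) = w * 1"
    using assms(1) by (simp add: power2_eq_square algebra_simps)
  then have "w * (1 + a\<^sup>2) = 1" using assms(2) by (simp only: mult_cancel_left) simp
  then show ?thesis by (rule eq_divide_imp[OF one_plus_square_neq_0])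
qed

lemma damp_bdd:
  assumes "f \<in> cont_funs X" shows "damp X f \<in> bdd_cont_funs X"
  unfolding damp_def
proof (rule restrict_in_bdd_cont_funs)
  show "continuous_map X euclideanreal (\<lambda>x. 1 / (1 + (f x)\<^sup>2))"
    by (intro continuous_map_real_divide continuous_map_add continuous_map_real_pow
        cont_funs_continuous[OF assms] one_plus_square_neq_0) simp_all
  show "\<bar>1 / (1 + (f x)\<^sup>2)\<bar> \<le> 1" for x
    using one_plus_square_pos[of "f x"] by (simp add: field_simps)
qed

lemma damped_bdd:
  assumes "f \<in> cont_funs X" shows "damped X f \<in> bdd_cont_funs X"
  unfolding damped_def
proof (rule restrict_in_bdd_cont_funs)
  show "continuous_map X euclideanreal (\<lambda>x. f x / (1 + (f x)\<^sup>2))"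
    by (intro continuous_map_real_divide continuous_map_add continuous_map_real_pow
        cont_funs_continuous[OF assms] one_plus_square_neq_0) simp_all
  show "\<bar>f x / (1 + (f x)\<^sup>2)\<bar> \<le> 1" for x
  proof -
    have "\<bar>f x\<bar> \<le> 1 + \<bar>f x\<bar>\<^sup>2"
    proof (cases "\<bar>f x\<bar> \<le> 1")
      case False
      then have "\<bar>f x\<bar> * 1 \<le> \<bar>f x\<bar> * \<bar>f x\<bar>" by (intro mult_left_mono) auto
      then show ?thesis by (simp add: power2_eq_square)
    qed (simp add: add_increasing2)
    then show ?thesis using one_plus_square_pos[of "f x"] by (simp add: abs_divide)
  qed
qed

lemma damped_eq: "x \<in> topspace X \<Longrightarrow> damped X f x = damp X f x * f x"
  by (simp add: damp_def damped_def)

text \<open>This is the equation of the circle on which the pair takes its values. In particular the second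
  function vanishes wherever the first one does.\<close>

lemma damp_relation:
  assumes f: "f \<in> cont_funs X" and p: "p \<in> topspace (stone_cech X)"
  shows "(p (damped X f))\<^sup>2 + (p (damp X f))\<^sup>2 = p (damp X f)"
proof -
  let ?w = "damp X f" and ?u = "damped X f"
  note w = damp_bdd[OF f] and u = damped_bdd[OF f]
  have eq: "?w = (\<lambda>x\<in>topspace X. (\<lambda>x\<in>topspace X. ?u x * ?u x) x + (\<lambda>x\<in>topspace X. ?w x * ?w x) x)"
    unfolding damp_def damped_def
  proof (rule restrict_ext)
    fix x assume "x \<in> topspace X"
    let ?s = "1 + (f x)\<^sup>2"
    have "f x / ?s * (f x / ?s) + 1 / ?s * (1 / ?s) = ?s / (?s * ?s)"
      by (simp add: add_divide_distrib power2_eq_square)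
    also have "\<dots> = 1 / ?s" using one_plus_square_neq_0[of "f x"] by simp
    finally have "1 / ?s = f x / ?s * (f x / ?s) + 1 / ?s * (1 / ?s)" ..
    then show "1 / (1 + (f x)\<^sup>2) =
      (\<lambda>x\<in>topspace X. (\<lambda>x\<in>topspace X. f x / (1 + (f x)\<^sup>2)) x * (\<lambda>x\<in>topspace X. f x / (1 + (f x)\<^sup>2)) x) x +
      (\<lambda>x\<in>topspace X. (\<lambda>x\<in>topspace X. 1 / (1 + (f x)\<^sup>2)) x * (\<lambda>x\<in>topspace X. 1 / (1 + (f x)\<^sup>2)) x) x"
      using \<open>x \<in> topspace X\<close> by (simp only: restrict_apply')
  qed
  have "p ?w = p ?u * p ?u + p ?w * p ?w"
    by (subst eq) (simp only: stone_cech_add[OF bdd_mult[OF u u] bdd_mult[OF w w] p]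
        stone_cech_mult[OF u u p] stone_cech_mult[OF w w p])
  then show ?thesis by (simp add: power2_eq_square)
qed

text \<open>A single denominator suffices to decide whether the value is finite: if $1/(1+f^2)$ vanishes at
  \<open>p\<close>, so does every admissible denominator.\<close>

lemma finite_value_iff:
  assumes f: "f \<in> cont_funs X" and p: "p \<in> topspace (stone_cech X)"
  shows "finite_value X p f a \<longleftrightarrow> p (damp X f) \<noteq> 0 \<and> p (damped X f) / p (damp X f) = a"
proof -
  note w0 = damp_bdd[OF f] and u0 = damped_bdd[OF f]
  have *: "finite_value X p f (p (damped X f) / p (damp X f))" if "p (damp X f) \<noteq> 0"
    by (rule finite_valueI[where w = "damp X f" and u = "damped X f"])
      (simp_all add: that damped_eq w0 u0)
  have "p (damp X f) \<noteq> 0" if fin: "finite_value X p f a"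
  proof
    assume zero: "p (damp X f) = 0"
    then have u0_zero: "p (damped X f) = 0" using damp_relation[OF f p] by simp
    obtain w u where w: "w \<in> bdd_cont_funs X" "p w \<noteq> 0" "u \<in> bdd_cont_funs X" "p u = p w * a"
      "\<forall>x\<in>topspace X. u x = w x * f x" by (rule finite_valueE[OF fin])
    \<comment> \<open>\<open>w = w / (1 + f\<^sup>2) + (w f) (f / (1 + f\<^sup>2))\<close>, and both second factors vanish at \<open>p\<close>.\<close>
    have "w = (\<lambda>x\<in>topspace X. w x)"
      using w(1) bdd_cont_funs_subset cont_funs_restrict by (metis subsetD)
    also have "\<dots> = (\<lambda>x\<in>topspace X. (\<lambda>x\<in>topspace X. w x * damp X f x) x +
        (\<lambda>x\<in>topspace X. u x * damped X f x) x)"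
    proof (rule restrict_ext)
      fix x assume x: "x \<in> topspace X"
      let ?s = "1 + (f x)\<^sup>2"
      have "w x * (1 / ?s) + w x * f x * (f x / ?s) = w x * (?s / ?s)"
        by (simp only: times_divide_eq_right add_divide_distrib[symmetric])
          (simp only: power2_eq_square distrib_left mult_1_right mult.assoc)
      also have "\<dots> = w x" using one_plus_square_neq_0[of "f x"] by simp
      finally have "w x = w x * (1 / ?s) + w x * f x * (f x / ?s)" ..
      then show "w x = (\<lambda>x\<in>topspace X. w x * damp X f x) x + (\<lambda>x\<in>topspace X. u x * damped X f x) x"
        by (simp only: damp_def damped_def restrict_apply'[OF x] bspec[OF w(5) x])
    qed
    finally have eq: "w = (\<lambda>x\<in>topspace X. (\<lambda>x\<in>topspace X. w x * damp X f x) x +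
        (\<lambda>x\<in>topspace X. u x * damped X f x) x)" .
    have "p w = p w * p (damp X f) + p u * p (damped X f)"
      by (subst eq) (simp only: stone_cech_add[OF bdd_mult[OF w(1) w0] bdd_mult[OF w(3) u0] p]
        stone_cech_mult[OF w(1) w0 p] stone_cech_mult[OF w(3) u0 p])
    then show False using zero u0_zero w(2) by simp
  qed
  then show ?thesis using * finite_value_unique[OF p] by blast
qed

lemma finite_value_embed:
  assumes "f \<in> cont_funs X" and "x \<in> topspace X"
  shows "finite_value X (sc_embed X x) f (f x)"
  unfolding finite_value_iff[OF assms(1) sc_embed_in_stone_cech[OF assms(2)]]
    sc_embed_apply[OF damp_bdd[OF assms(1)]] sc_embed_apply[OF damped_bdd[OF assms(1)]]
  using assms(2) one_plus_square_neq_0[of "f x"] by (simp add: damp_def damped_def)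

text \<open>Only neighbourhoods of infinity need an argument. On the preimage of a compact set $C$ of reals,
  bounded by $n$, the denominator is at least $1/(1+n^2)$ by the circle equation; replacing it by its
  maximum with this constant makes the quotient continuous everywhere, so the preimage is closed.\<close>

lemma continuous_map_finite_value:
  assumes f: "f \<in> cont_funs X"
  shows "continuous_map (stone_cech X) (Alexandroff_compactification euclideanreal)
    (\<lambda>p\<in>topspace (stone_cech X).
       if p (damp X f) = 0 then None else Some (p (damped X f) / p (damp X f)))"
    (is "continuous_map ?S _ ?F")
proof -
  let ?w = "\<lambda>p. p (damp X f)" and ?u = "\<lambda>p. p (damped X f)"
  have w: "continuous_map ?S euclideanreal ?w" and u: "continuous_map ?S euclideanreal ?u"
    by (rule continuous_map_stone_cech_coordinate, rule damp_bdd damped_bdd, rule f)+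
  have F: "?F p = (if ?w p = 0 then None else Some (?u p / ?w p))" if "p \<in> topspace ?S" for p
    using that by simp
  have "openin ?S {p \<in> topspace ?S. ?F p \<in> V}"
    if V: "openin (Alexandroff_compactification euclideanreal) V" for V
  proof -
    consider U where "open U" "V = Some ` U"
      | C where "compact C" "V = insert None (Some ` (UNIV - C))"
      using V by (auto simp: openin_Alexandroff_compactification)
    then show ?thesis
    proof cases
      case 1
      let ?O = "{p \<in> topspace ?S. ?w p \<in> UNIV - {0}}"
      have O: "openin ?S ?O"
        by (rule openin_continuous_map_preimage[OF w]) auto
      have "continuous_map (subtopology ?S ?O) euclideanreal (\<lambda>p. ?u p / ?w p)"
        by (intro continuous_map_real_divide continuous_map_from_subtopology w u) auto
      then have "openin (subtopology ?S ?O) {p \<in> topspace (subtopology ?S ?O). ?u p / ?w p \<in> U}"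
        by (rule openin_continuous_map_preimage) (simp add: 1)
      then have "openin ?S {p \<in> topspace (subtopology ?S ?O). ?u p / ?w p \<in> U}"
        using openin_open_subtopology[OF O] by blast
      also have "{p \<in> topspace (subtopology ?S ?O). ?u p / ?w p \<in> U} = {p \<in> topspace ?S. ?F p \<in> V}"
        using F by (auto simp: 1(2))
      finally show ?thesis .
    next
      case 2
      obtain n where n: "\<And>c. c \<in> C \<Longrightarrow> \<bar>c\<bar> \<le> n"
        using compact_imp_bounded[OF 2(1)] by (auto simp: bounded_iff)
      define e where "e = 1 / (1 + n\<^sup>2)"
      have e: "e > 0" using one_plus_square_pos[of n] by (simp add: e_def)
      have big: "e \<le> ?w p" if p: "p \<in> topspace ?S" "?w p \<noteq> 0" "?u p / ?w p \<in> C" for p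
      proof -
        let ?a = "?u p / ?w p"
        have "?a\<^sup>2 * (?w p)\<^sup>2 + (?w p)\<^sup>2 = ?w p"
          using damp_relation[OF f p(1)] p(2) by (simp add: power_divide)
        then have wp: "?w p = 1 / (1 + ?a\<^sup>2)" using p(2) by (rule quadratic_root)
        have "?a\<^sup>2 \<le> n\<^sup>2" using n[OF p(3)] by (simp only: abs_le_square_iff[symmetric])
        then show ?thesis unfolding e_def by (subst wp) (rule frac_le, simp_all add: one_plus_square_pos)
      qed
      let ?q = "\<lambda>p. ?u p / max (?w p) e"
      have q: "continuous_map ?S euclideanreal ?q"
        by (intro continuous_map_real_divide continuous_map_real_max w u) (use e in auto)
      have "closedin ?S ({p \<in> topspace ?S. ?w p \<in> {e..}} \<inter> {p \<in> topspace ?S. ?q p \<in> C})"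
        by (intro closedin_Int closedin_continuous_map_preimage[OF w]
            closedin_continuous_map_preimage[OF q])
          (use 2 compact_imp_closed in auto)
      moreover have "topspace ?S - ({p \<in> topspace ?S. ?w p \<in> {e..}} \<inter> {p \<in> topspace ?S. ?q p \<in> C})
          = {p \<in> topspace ?S. ?F p \<in> V}" (is "?L = ?R")
      proof -
        have "p \<in> ?L \<longleftrightarrow> p \<in> ?R" if p: "p \<in> topspace ?S" for p
        proof -
          have "?w p \<in> {e..} \<and> ?q p \<in> C \<longleftrightarrow> ?w p \<noteq> 0 \<and> ?u p / ?w p \<in> C"
            using big[OF p] e by (auto simp: max_def)
          then show ?thesis using p F[OF p] by (auto simp: 2(2))
        qed
        then show ?thesis by blast
      qed
      ultimately show ?thesis by (metis (no_types, lifting) closedin_def)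
    qed
  qed
  then show ?thesis
    by (auto simp: continuous_map_def)
qed

lemma sc_ext_eq:
  assumes f: "f \<in> cont_funs X"
  shows "sc_ext X f = (\<lambda>p\<in>topspace (stone_cech X).
       if p (damp X f) = 0 then None else Some (p (damped X f) / p (damp X f)))"
    (is "_ = ?F")
  unfolding sc_ext_def
proof (rule the_equality)
  have F: "?F (sc_embed X x) = Some (f x)" if x: "x \<in> topspace X" for x
    using finite_value_embed[OF f x]
    unfolding finite_value_iff[OF f sc_embed_in_stone_cech[OF x]]
    by (simp add: sc_embed_in_stone_cech[OF x])
  show "?F \<in> extensional (topspace (stone_cech X)) \<and>
      continuous_map (stone_cech X) (Alexandroff_compactification euclideanreal) ?F \<and>
      (\<forall>x\<in>topspace X. ?F (sc_embed X x) = Some (f x))"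
    using continuous_map_finite_value[OF f] F by simp
  fix G assume G: "G \<in> extensional (topspace (stone_cech X)) \<and>
      continuous_map (stone_cech X) (Alexandroff_compactification euclideanreal) G \<and>
      (\<forall>x\<in>topspace X. G (sc_embed X x) = Some (f x))"
  have "G p = ?F p" if p: "p \<in> topspace (stone_cech X)" for p
  proof (rule forall_in_closure_of_eq[where X = "stone_cech X" and x = p and f = G and g = ?F
        and Y = "Alexandroff_compactification euclideanreal" and S = "sc_embed X ` topspace X"])
    show "p \<in> (stone_cech X) closure_of (sc_embed X ` topspace X)"
      using p by (simp add: stone_cech_dense)
    show "Hausdorff_space (Alexandroff_compactification euclideanreal)"
      by (simp add: Hausdorff_space_Alexandroff_compactification locally_compact_space_euclidean)
    show "continuous_map (stone_cech X) (Alexandroff_compactification euclideanreal) ?F"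
      by (rule continuous_map_finite_value[OF f])
    show "G r = ?F r" if r: "r \<in> sc_embed X ` topspace X" for r
    proof -
      from r obtain x where x: "r = sc_embed X x" "x \<in> topspace X" by (rule imageE)
      show ?thesis unfolding x(1) F[OF x(2)] using G x(2) by blast
    qed
  qed (use G in blast)
  then show "G = ?F"
    using G by (intro extensionalityI[where A = "topspace (stone_cech X)"]) auto
qed

lemma sc_ext_eq_Some_iff:
  assumes f: "f \<in> cont_funs X" and p: "p \<in> topspace (stone_cech X)"
  shows "sc_ext X f p = Some a \<longleftrightarrow> finite_value X p f a"
  unfolding finite_value_iff[OF f p] sc_ext_eq[OF f] using p by auto

section \<open>Maximal ideals of intermediate rings\<close>

definition function_algebra :: "'a topology \<Rightarrow> ('a \<Rightarrow> real) set \<Rightarrow> bool" where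
  "function_algebra X A \<longleftrightarrow> bdd_cont_funs X \<subseteq> A \<and> A \<subseteq> cont_funs X \<and>
     (\<forall>f\<in>A. \<forall>g\<in>A. (\<lambda>x\<in>topspace X. f x + g x) \<in> A \<and> (\<lambda>x\<in>topspace X. f x * g x) \<in> A)"

lemma function_algebraD:
  assumes "function_algebra X A"
  shows "f \<in> bdd_cont_funs X \<Longrightarrow> f \<in> A" and "f \<in> A \<Longrightarrow> f \<in> cont_funs X"
    and "\<lbrakk>f \<in> A; g \<in> A\<rbrakk> \<Longrightarrow> (\<lambda>x\<in>topspace X. f x + g x) \<in> A"
    and "\<lbrakk>f \<in> A; g \<in> A\<rbrakk> \<Longrightarrow> (\<lambda>x\<in>topspace X. f x * g x) \<in> A"
    and "(\<lambda>x\<in>topspace X. c) \<in> A"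
  using assms bdd_const[where c = c and X = X] by (auto simp only: function_algebra_def subset_iff)

lemma function_algebra_scale:
  assumes "function_algebra X A" and "f \<in> A"
  shows "(\<lambda>x\<in>topspace X. c * f x) \<in> A"
proof -
  have "(\<lambda>x\<in>topspace X. (\<lambda>x\<in>topspace X. c) x * f x) \<in> A"
    by (rule function_algebraD(4)[OF assms(1) function_algebraD(5)[OF assms(1)] assms(2)])
  then show ?thesis by (simp cong: restrict_cong)
qed

lemma intermediate_ring_imp_function_algebra:
  assumes "intermediate_ring X A"
  shows "function_algebra X A"
proof -
  have A: "subring A (fun_ring X (cont_funs X))" "bdd_cont_funs X \<subseteq> A" "A \<subseteq> cont_funs X"
    using assms by (simp_all add: intermediate_ring_def)
  show ?thesis
    unfolding function_algebra_def
    using A(2,3) subringE(6,7)[OF A(1)] by (simp add: fun_ring_def)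
qed

lemma continuous_map_sc_embed: "continuous_map X (stone_cech X) (sc_embed X)"
proof -
  have "continuous_map X (product_topology (\<lambda>_. euclideanreal) (bdd_cont_funs X)) (sc_embed X)"
    unfolding continuous_map_componentwise
    by (auto simp: sc_embed_apply bdd_cont_funs_continuous sc_embed_def)
  then show ?thesis
    by (subst stone_cech_eq) (simp add: continuous_map_in_subtopology sc_embed_in_stone_cech)
qed

lemma completely_regular_stone_cech: "completely_regular_space (stone_cech X)"
proof -
  have "completely_regular_space euclideanreal"
    by (rule metrizable_imp_completely_regular_space) (rule metrizable_space_euclidean)
  then show ?thesis
    by (subst stone_cech_eq)
      (intro completely_regular_space_subtopology, simp add: completely_regular_space_product_topology)
qed

text \<open>The compactification is a subspace of a product of lines and hence completely regular, and a
  continuous function on it restricts to a bounded function on the space.\<close>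

lemma separate_from_closure:
  assumes E: "E \<subseteq> topspace X" and p: "p \<in> topspace (stone_cech X)"
    and notin: "p \<notin> (stone_cech X) closure_of (sc_embed X ` E)"
  shows "\<exists>b\<in>bdd_cont_funs X. p b = 1 \<and> (\<forall>x\<in>E. b x = 0)"
proof -
  let ?C = "(stone_cech X) closure_of (sc_embed X ` E)"
  obtain G where G: "continuous_map (stone_cech X) (top_of_set {0..1::real}) G"
    and Gp: "G p = 0" and GC: "G ` ?C \<subseteq> {1}"
  proof -
    have "closedin (stone_cech X) ?C \<and> p \<in> topspace (stone_cech X) - ?C"
      using p notin by simp
    then show thesis
      using completely_regular_stone_cech[of X] that unfolding completely_regular_space_def by metis
  qed
  have Gcont: "continuous_map (stone_cech X) euclideanreal G"
    and Gbd: "\<And>r. r \<in> topspace (stone_cech X) \<Longrightarrow> G r \<in> {0..1}"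
    using G by (auto simp: continuous_map_in_subtopology)
  define b where "b = (\<lambda>x\<in>topspace X. 1 - G (sc_embed X x))"
  have b: "b \<in> bdd_cont_funs X"
    unfolding b_def
  proof (rule restrict_in_bdd_cont_funs)
    have "continuous_map X euclideanreal (G \<circ> sc_embed X)"
      by (rule continuous_map_compose[OF continuous_map_sc_embed Gcont])
    then show "continuous_map X euclideanreal (\<lambda>x. 1 - G (sc_embed X x))"
      by (intro continuous_map_diff) (simp_all add: o_def)
    show "\<bar>1 - G (sc_embed X x)\<bar> \<le> 1" if "x \<in> topspace X" for x
      using Gbd[OF sc_embed_in_stone_cech[OF that]] by auto
  qed
  have "p b = 1 - G p"
  proof (rule forall_in_closure_of_eq[where X = "stone_cech X" and x = p and Y = euclideanreal
        and f = "\<lambda>r. r b" and g = "\<lambda>r. 1 - G r" and S = "sc_embed X ` topspace X"])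
    show "p \<in> (stone_cech X) closure_of (sc_embed X ` topspace X)"
      using p by (simp add: stone_cech_dense)
    show "continuous_map (stone_cech X) euclideanreal (\<lambda>r. r b)"
      by (rule continuous_map_stone_cech_coordinate[OF b])
    show "continuous_map (stone_cech X) euclideanreal (\<lambda>r. 1 - G r)"
      by (intro continuous_map_diff Gcont) simp
    show "r b = 1 - G r" if r: "r \<in> sc_embed X ` topspace X" for r
    proof -
      from r obtain x where x: "r = sc_embed X x" "x \<in> topspace X" by (rule imageE)
      show ?thesis unfolding x(1) sc_embed_apply[OF b] using x(2) by (simp add: b_def)
    qed
  qed simp
  moreover have "b x = 0" if x: "x \<in> E" for x
  proof -
    have "sc_embed X ` E \<subseteq> ?C"
      using E by (intro closure_of_subset image_subsetI sc_embed_in_stone_cech) (rule subsetD)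
    then have "G (sc_embed X x) = 1" using GC x by (auto simp only: image_subset_iff singleton_iff)
    then show ?thesis using x E by (auto simp: b_def)
  qed
  ultimately show ?thesis using b Gp by (intro bexI[of _ b]) simp_all
qed

lemma bound_on_closure:
  assumes d: "d \<in> bdd_cont_funs X" and bd: "\<And>x. x \<in> E \<Longrightarrow> \<bar>d x\<bar> \<le> c"
    and p: "p \<in> (stone_cech X) closure_of (sc_embed X ` E)"
  shows "\<bar>p d\<bar> \<le> c"
proof (rule forall_in_closure_of[OF p])
  show "\<bar>r d\<bar> \<le> c" if r: "r \<in> sc_embed X ` E" for r
  proof -
    from r obtain x where x: "r = sc_embed X x" "x \<in> E" by (rule imageE)
    show ?thesis unfolding x(1) sc_embed_apply[OF d] by (rule bd[OF x(2)])
  qed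
  have "closedin (stone_cech X) {r \<in> topspace (stone_cech X). \<bar>r d\<bar> \<in> {..c}}"
    by (rule closedin_continuous_map_preimage[where Y = euclideanreal])
      (auto intro: continuous_map_real_abs continuous_map_stone_cech_coordinate[OF d])
  then show "closedin (stone_cech X) {r \<in> topspace (stone_cech X). \<bar>r d\<bar> \<le> c}" by simp
qed

lemma one_minus_damp:
  assumes "x \<in> topspace X"
  shows "1 - damp X h x = h x * damped X h x"
proof -
  let ?s = "1 + (h x)\<^sup>2"
  have "1 - 1 / ?s = ?s / ?s - 1 / ?s" using one_plus_square_neq_0[of "h x"] by simp
  also have "\<dots> = (?s - 1) / ?s" by (simp only: diff_divide_distrib)
  also have "\<dots> = h x * (h x / ?s)" by (simp add: power2_eq_square)
  finally show ?thesis using assms by (simp only: damp_def damped_def restrict_apply')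
qed

text \<open>If $h = fg$ does not have value zero at \<open>p\<close>, then $h^2/(1+h^2)$ is at least some $c > 0$ near \<open>p\<close>,
  and there \<open>f\<close> can be inverted inside the algebra by \<open>g\<close> times a bounded function. Conversely, if
  $fg = 1$ off a zero set whose closure misses \<open>p\<close>, then $fg = 1$ near \<open>p\<close>.\<close>

lemma max_ideal_iff:
  assumes A: "function_algebra X A" and p: "p \<in> topspace (stone_cech X)"
  shows "f \<in> max_ideal X A p \<longleftrightarrow>
    f \<in> A \<and> (\<forall>g\<in>A. finite_value X p (\<lambda>x\<in>topspace X. f x * g x) 0)"
proof (intro iffI conjI ballI)
  assume M: "f \<in> max_ideal X A p"
  then show f: "f \<in> A" by (simp add: max_ideal_def)
  fix g assume g: "g \<in> A"
  define h where "h = (\<lambda>x\<in>topspace X. f x * g x)"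
  have hx: "h x = f x * g x" if "x \<in> topspace X" for x using that by (simp add: h_def)
  have h: "h \<in> cont_funs X"
    using function_algebraD(2)[OF A function_algebraD(4)[OF A f g]] by (simp only: h_def)
  note w = damp_bdd[OF h] and u = damped_bdd[OF h]
  \<comment> \<open>This is $h^2/(1+h^2)$, a bounded function that vanishes exactly where \<open>h\<close> does.\<close>
  define d where "d = (\<lambda>x\<in>topspace X. 1 - damp X h x)"
  have d: "d \<in> bdd_cont_funs X"
    unfolding d_def by (rule bdd_comp[OF _ w]) (intro continuous_intros)
  have pd: "p d = 1 - p (damp X h)"
    unfolding d_def by (rule stone_cech_comp[OF _ w p]) (intro continuous_intros)
  have dx: "d x = h x * damped X h x" if "x \<in> topspace X" for x
    using one_minus_damp[OF that] that by (simp add: d_def)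
  have d_nonneg: "0 \<le> d x" if "x \<in> topspace X" for x
    using dx[OF that] one_plus_square_pos[of "h x"] that by (simp add: damped_def)
  show "finite_value X p (\<lambda>x\<in>topspace X. f x * g x) 0"
  proof (rule ccontr)
    assume "\<not> ?thesis"
    then have not0: "\<not> finite_value X p h 0" by (simp add: h_def)
    have "p d \<noteq> 0"
    proof
      assume "p d = 0"
      then have "p (damp X h) = 1" using pd by simp
      then show False using damp_relation[OF h p] not0 finite_value_iff[OF h p, of 0] by simp
    qed
    define c where "c = \<bar>p d\<bar> / 2"
    have c: "0 < c" "c < \<bar>p d\<bar>" using \<open>p d \<noteq> 0\<close> by (simp_all add: c_def)
    define E where "E = {x \<in> topspace X. (\<lambda>x\<in>topspace X. max (d x - c) 0) x = 0}"
    have E: "x \<in> E \<longleftrightarrow> x \<in> topspace X \<and> d x \<le> c" for x by (auto simp: E_def max_def)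
    have "zero_set X E"
      unfolding zero_set_def E_def
    proof (rule bexI[where x = "\<lambda>x\<in>topspace X. max (d x - c) 0"], rule refl)
      show "(\<lambda>x\<in>topspace X. max (d x - c) 0) \<in> cont_funs X"
        by (intro restrict_in_cont_funs continuous_map_real_max continuous_map_diff
            bdd_cont_funs_continuous[OF d]) simp_all
    qed
    \<comment> \<open>Off \<open>E\<close> this is $1/h$; the maximum keeps it bounded on all of the space.\<close>
    define b where "b = (\<lambda>x\<in>topspace X. damped X h x / max (d x) c)"
    have b: "b \<in> bdd_cont_funs X"
    proof -
      obtain m where m: "\<And>x. x \<in> topspace X \<Longrightarrow> \<bar>damped X h x\<bar> \<le> m"
        using bdd_cont_funs_bound[OF u] by blast
      show ?thesis
        unfolding b_def
      proof (rule restrict_in_bdd_cont_funs)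
        show "continuous_map X euclideanreal (\<lambda>x. damped X h x / max (d x) c)"
          by (intro continuous_map_real_divide continuous_map_real_max
              bdd_cont_funs_continuous[OF d] bdd_cont_funs_continuous[OF u]) (use c in auto)
        show "\<bar>damped X h x / max (d x) c\<bar> \<le> m / c" if "x \<in> topspace X" for x
        proof -
          have "\<bar>damped X h x\<bar> / \<bar>max (d x) c\<bar> \<le> m / c"
            by (rule frac_le) (use m[OF that] c in \<open>auto intro: order_trans[OF abs_ge_zero]\<close>)
          then show ?thesis by (simp only: abs_divide)
        qed
      qed
    qed
    define k where "k = (\<lambda>x\<in>topspace X. g x * b x)"
    have k: "k \<in> A" unfolding k_def by (rule function_algebraD(4)[OF A g function_algebraD(1)[OF A b]])
    have "f x * k x = 1" if x: "x \<in> topspace X - E" for x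
    proof -
      have lt: "d x > c" and xX: "x \<in> topspace X" using x E[of x] by auto
      have "k x = g x * (damped X h x / d x)"
        using lt xX by (simp add: k_def b_def max_absorb1)
      then have "f x * k x = f x * g x * damped X h x / d x" by simp
      also have "\<dots> = d x / d x" by (simp only: dx[OF xX] hx[OF xX])
      finally show ?thesis using lt c by simp
    qed
    then have "E \<in> zsets X A f" using \<open>zero_set X E\<close> k by (auto simp: zsets_def)
    then have "p \<in> (stone_cech X) closure_of (sc_embed X ` E)" using M by (simp add: max_ideal_def)
    then have "\<bar>p d\<bar> \<le> c" by (rule bound_on_closure[OF d, rotated]) (simp add: E d_nonneg)
    then show False using c by simp
  qed
next
  assume f: "f \<in> A \<and> (\<forall>g\<in>A. finite_value X p (\<lambda>x\<in>topspace X. f x * g x) 0)"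
  have "p \<in> (stone_cech X) closure_of (sc_embed X ` E)" if "E \<in> zsets X A f" for E
  proof (rule ccontr)
    assume notin: "\<not> ?thesis"
    from that obtain g where g: "g \<in> A" "\<And>x. x \<in> topspace X - E \<Longrightarrow> f x * g x = 1"
      and E: "E \<subseteq> topspace X"
      by (auto simp: zsets_def zero_set_def)
    from separate_from_closure[OF E p notin] obtain b
      where b: "b \<in> bdd_cont_funs X" "p b = 1" "\<And>x. x \<in> E \<Longrightarrow> b x = 0" by blast
    have "finite_value X p (\<lambda>x\<in>topspace X. b x * (\<lambda>x\<in>topspace X. f x * g x) x) (p b * 0)"
      by (intro finite_value_mult[OF p finite_value_bdd[OF p b(1)]]) (use f g in blast)
    moreover have "b x * (\<lambda>x\<in>topspace X. f x * g x) x = b x" if "x \<in> topspace X" for x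
      using that b(3)[of x] g(2)[of x] by (cases "x \<in> E") auto
    ultimately have "finite_value X p b 0"
      using finite_value_cong[of X "\<lambda>x\<in>topspace X. b x * (\<lambda>x\<in>topspace X. f x * g x) x" b p 0]
      by simp
    then show False using finite_value_bdd_eq[OF p b(1)] b(2) by fastforce
  qed
  then show "f \<in> max_ideal X A p" using f by (simp add: max_ideal_def)
qed

lemma max_ideal_value_zero:
  assumes A: "function_algebra X A" and p: "p \<in> topspace (stone_cech X)" and f: "f \<in> max_ideal X A p"
  shows "finite_value X p f 0"
proof -
  have "finite_value X p (\<lambda>x\<in>topspace X. f x * (\<lambda>x\<in>topspace X. 1) x) 0"
    using f max_ideal_iff[OF A p] function_algebraD(5)[OF A, of 1] by blast
  then show ?thesis
    using finite_value_cong[of X "\<lambda>x\<in>topspace X. f x * (\<lambda>x\<in>topspace X. 1) x" f p 0] by simp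
qed

lemma max_ideal_add:
  assumes A: "function_algebra X A" and p: "p \<in> topspace (stone_cech X)"
    and f: "f \<in> max_ideal X A p" and g: "g \<in> max_ideal X A p"
  shows "(\<lambda>x\<in>topspace X. f x + g x) \<in> max_ideal X A p"
proof -
  note iff = max_ideal_iff[OF A p]
  have fA: "f \<in> A" and gA: "g \<in> A" using f g by (simp_all add: iff)
  show ?thesis
    unfolding iff
  proof (intro conjI ballI)
    show "(\<lambda>x\<in>topspace X. f x + g x) \<in> A" by (rule function_algebraD(3)[OF A fA gA])
    fix h assume h: "h \<in> A"
    have "finite_value X p (\<lambda>x\<in>topspace X. (\<lambda>x\<in>topspace X. f x * h x) x + (\<lambda>x\<in>topspace X. g x * h x) x) (0 + 0)"
      by (rule finite_value_add[OF p]) (use f g h iff in blast)+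
    then show "finite_value X p (\<lambda>x\<in>topspace X. (\<lambda>x\<in>topspace X. f x + g x) x * h x) 0"
      by (simp add: distrib_right cong: restrict_cong)
  qed
qed

lemma max_ideal_mult:
  assumes A: "function_algebra X A" and p: "p \<in> topspace (stone_cech X)"
    and f: "f \<in> max_ideal X A p" and g: "g \<in> A"
  shows "(\<lambda>x\<in>topspace X. f x * g x) \<in> max_ideal X A p"
proof -
  note iff = max_ideal_iff[OF A p]
  have fA: "f \<in> A" using f by (simp add: iff)
  show ?thesis
    unfolding iff
  proof (intro conjI ballI)
    show "(\<lambda>x\<in>topspace X. f x * g x) \<in> A" by (rule function_algebraD(4)[OF A fA g])
    fix h assume h: "h \<in> A"
    have "finite_value X p (\<lambda>x\<in>topspace X. f x * (\<lambda>x\<in>topspace X. g x * h x) x) 0"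
      using f iff function_algebraD(4)[OF A g h] by blast
    then show "finite_value X p (\<lambda>x\<in>topspace X. (\<lambda>x\<in>topspace X. f x * g x) x * h x) 0"
      by (simp add: mult.assoc cong: restrict_cong)
  qed
qed

text \<open>The hypothesis on \<open>b\<close> says that \<open>f\<close> vanishes on a neighbourhood of \<open>p\<close>.\<close>

lemma locally_zero_in_max_ideal:
  assumes A: "function_algebra X A" and p: "p \<in> topspace (stone_cech X)" and f: "f \<in> A"
    and b: "b \<in> bdd_cont_funs X" "p b \<noteq> 0" "\<And>x. x \<in> topspace X \<Longrightarrow> b x * f x = 0"
  shows "f \<in> max_ideal X A p"
  unfolding max_ideal_iff[OF A p]
proof (intro conjI ballI f)
  fix g assume "g \<in> A"
  show "finite_value X p (\<lambda>x\<in>topspace X. f x * g x) 0"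
    by (rule finite_valueI[where w = b and u = "\<lambda>x\<in>topspace X. 0"])
      (use b in \<open>simp_all only: bdd_const stone_cech_const[OF p]\<close>, use b in auto)
qed

text \<open>A bounded function \<open>f\<close> that distinguishes the two points is truncated so as to vanish near \<open>p\<close>
  without vanishing at \<open>y\<close>. In particular the bounded members of a maximal ideal determine its
  point.\<close>

lemma max_ideal_separates:
  assumes A: "function_algebra X A" and p: "p \<in> topspace (stone_cech X)"
    and y: "y \<in> topspace (stone_cech X)" and neq: "y \<noteq> p"
  shows "\<exists>g\<in>bdd_cont_funs X. g \<in> max_ideal X A p \<and> y g \<noteq> 0"
proof -
  have "\<exists>f\<in>bdd_cont_funs X. p f \<noteq> y f"
    using neq extensionalityI[OF stone_cech_extensional[OF y] stone_cech_extensional[OF p]] by metis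
  then obtain f where f: "f \<in> bdd_cont_funs X" "p f \<noteq> y f" by blast
  define t where "t = \<bar>y f - p f\<bar> / 2"
  have t: "t > 0" using f by (simp add: t_def)
  define g where "g = (\<lambda>x\<in>topspace X. max (\<bar>f x - p f\<bar> - t) 0)"
  define b where "b = (\<lambda>x\<in>topspace X. max (t - \<bar>f x - p f\<bar>) 0)"
  have cont: "continuous_on UNIV (\<lambda>s. max (\<bar>s - p f\<bar> - t) 0)"
    "continuous_on UNIV (\<lambda>s. max (t - \<bar>s - p f\<bar>) 0)"
    by (intro continuous_intros)+
  have g: "g \<in> bdd_cont_funs X" "y g = max (\<bar>y f - p f\<bar> - t) 0"
    unfolding g_def by (rule bdd_comp[OF cont(1) f(1)]) (rule stone_cech_comp[OF cont(1) f(1) y])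
  have b: "b \<in> bdd_cont_funs X" "p b = max (t - \<bar>p f - p f\<bar>) 0"
    unfolding b_def by (rule bdd_comp[OF cont(2) f(1)]) (rule stone_cech_comp[OF cont(2) f(1) p])
  have "g \<in> max_ideal X A p"
    by (rule locally_zero_in_max_ideal[OF A p function_algebraD(1)[OF A g(1)] b(1)])
      (use b(2) t in \<open>auto simp: g_def b_def max_def\<close>)
  moreover have "y g \<noteq> 0" using g(2) f(2) by (simp add: t_def)
  ultimately show ?thesis using g(1) by blast
qed

section \<open>Residue fields and real points\<close>

lemma fun_ring_simps [simp]:
  "carrier (fun_ring X A) = A"
  "f \<otimes>\<^bsub>fun_ring X A\<^esub> g = (\<lambda>x\<in>topspace X. f x * g x)"
  "f \<oplus>\<^bsub>fun_ring X A\<^esub> g = (\<lambda>x\<in>topspace X. f x + g x)"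
  "\<one>\<^bsub>fun_ring X A\<^esub> = (\<lambda>x\<in>topspace X. 1)"
  "\<zero>\<^bsub>fun_ring X A\<^esub> = (\<lambda>x\<in>topspace X. 0)"
  by (simp_all add: fun_ring_def)

lemma function_algebra_restrict:
  assumes "function_algebra X A" and "f \<in> A"
  shows "(\<lambda>x\<in>topspace X. f x) = f"
  by (rule cont_funs_restrict[OF function_algebraD(2)[OF assms]])

lemma function_algebra_cring:
  assumes A: "function_algebra X A"
  shows "cring (fun_ring X A)"
proof (rule cringI)
  show "abelian_group (fun_ring X A)"
  proof (rule abelian_groupI)
    show "\<exists>g\<in>carrier (fun_ring X A). g \<oplus>\<^bsub>fun_ring X A\<^esub> f = \<zero>\<^bsub>fun_ring X A\<^esub>"
      if "f \<in> carrier (fun_ring X A)" for f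
      using function_algebra_scale[OF A, of f "- 1"] that
      by (intro bexI[where x = "\<lambda>x\<in>topspace X. - 1 * f x"]) (simp_all cong: restrict_cong)
  qed (use function_algebraD[OF A] function_algebra_restrict[OF A] in
      \<open>simp_all add: ac_simps cong: restrict_cong\<close>)
  show "comm_monoid (fun_ring X A)"
    by (rule comm_monoidI)
      (use function_algebraD[OF A] function_algebra_restrict[OF A] in
        \<open>simp_all add: ac_simps cong: restrict_cong\<close>)
qed (simp add: distrib_right cong: restrict_cong)

lemma fun_ring_minus:
  assumes A: "function_algebra X A" and f: "f \<in> A" and g: "g \<in> A"
  shows "f \<ominus>\<^bsub>fun_ring X A\<^esub> g = (\<lambda>x\<in>topspace X. f x - g x)"
proof -
  interpret cring "fun_ring X A" by (rule function_algebra_cring[OF A])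
  have "\<ominus>\<^bsub>fun_ring X A\<^esub> g = (\<lambda>x\<in>topspace X. - 1 * g x)"
    by (rule minus_equality)
      (use function_algebra_scale[OF A g, of "- 1"] g in \<open>simp_all cong: restrict_cong\<close>)
  then show ?thesis by (simp add: a_minus_def cong: restrict_cong)
qed

lemma max_ideal_subset: "max_ideal X A p \<subseteq> A"
  by (auto simp: max_ideal_def)

lemma max_ideal_ideal:
  assumes A: "function_algebra X A" and p: "p \<in> topspace (stone_cech X)"
  shows "ideal (max_ideal X A p) (fun_ring X A)"
proof -
  interpret cring "fun_ring X A" by (rule function_algebra_cring[OF A])
  let ?M = "max_ideal X A p"
  have zero: "(\<lambda>x\<in>topspace X. 0) \<in> ?M"
    by (rule locally_zero_in_max_ideal[OF A p function_algebraD(5)[OF A] bdd_const[where c = 1]])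
      (simp_all only: stone_cech_const[OF p], simp_all)
  have neg: "\<ominus>\<^bsub>fun_ring X A\<^esub> f \<in> ?M" if f: "f \<in> ?M" for f
  proof -
    have fA: "f \<in> A" using f max_ideal_subset by blast
    have "\<ominus>\<^bsub>fun_ring X A\<^esub> f = (\<lambda>x\<in>topspace X. f x * (\<lambda>x\<in>topspace X. - 1) x)"
      by (rule minus_equality)
        (use function_algebra_scale[OF A fA, of "- 1"] fA in \<open>simp_all cong: restrict_cong\<close>)
    then show ?thesis
      using max_ideal_mult[OF A p f function_algebraD(5)[OF A, of "- 1"]] by simp
  qed
  show ?thesis
  proof (rule idealI)
    show "subgroup ?M (add_monoid (fun_ring X A))"
    proof (rule group.subgroupI[OF a_group])
      show "?M \<noteq> {}" using zero by blast
      show "inv\<^bsub>add_monoid (fun_ring X A)\<^esub> f \<in> ?M" if "f \<in> ?M" for f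
        using neg[OF that] by (simp add: a_inv_def)
    qed (use max_ideal_subset max_ideal_add[OF A p] in auto)
    fix f g assume f: "f \<in> ?M" and g: "g \<in> carrier (fun_ring X A)"
    show fg: "f \<otimes>\<^bsub>fun_ring X A\<^esub> g \<in> ?M"
      using max_ideal_mult[OF A p f] g by simp
    show "g \<otimes>\<^bsub>fun_ring X A\<^esub> f \<in> ?M"
      using fg unfolding fun_ring_simps by (simp only: mult.commute)
  qed (rule ring_axioms)
qed

text \<open>The quotient map for an arbitrary intermediate ring; for $A^\nu$ it is \<open>theta\<close>.\<close>

definition coset ::
    "'a topology \<Rightarrow> ('a \<Rightarrow> real) set \<Rightarrow> (('a \<Rightarrow> real) \<Rightarrow> real) \<Rightarrow> ('a \<Rightarrow> real) \<Rightarrow> ('a \<Rightarrow> real) set"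
  where "coset X A p f = max_ideal X A p +>\<^bsub>fun_ring X A\<^esub> f"

lemma coset_eq_iff:
  assumes A: "function_algebra X A" and p: "p \<in> topspace (stone_cech X)" and "f \<in> A" "g \<in> A"
  shows "coset X A p f = coset X A p g \<longleftrightarrow> (\<lambda>x\<in>topspace X. f x - g x) \<in> max_ideal X A p"
  unfolding coset_def fun_ring_minus[OF assms(1,3,4), symmetric]
  using ring.quotient_eq_iff_same_a_r_cos[OF cring.axioms(1)[OF function_algebra_cring[OF A]]
      max_ideal_ideal[OF A p]] assms(3,4) by simp

lemma coset_ring_hom:
  assumes A: "function_algebra X A" and p: "p \<in> topspace (stone_cech X)"
  shows "coset X A p \<in> ring_hom (fun_ring X A) (residue_field X A p)"
  using ideal.rcos_ring_hom[OF max_ideal_ideal[OF A p]]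
  unfolding residue_field_def coset_def .

lemma residue_field_carrier: "carrier (residue_field X A p) = coset X A p ` A"
  by (auto simp: residue_field_def coset_def FactRing_def A_RCOSETS_def')

lemma coset_simps:
  assumes A: "function_algebra X A" and p: "p \<in> topspace (stone_cech X)"
  shows "\<lbrakk>f \<in> A; g \<in> A\<rbrakk> \<Longrightarrow> coset X A p f \<otimes>\<^bsub>residue_field X A p\<^esub> coset X A p g =
      coset X A p (\<lambda>x\<in>topspace X. f x * g x)"
    and "\<lbrakk>f \<in> A; g \<in> A\<rbrakk> \<Longrightarrow> coset X A p f \<oplus>\<^bsub>residue_field X A p\<^esub> coset X A p g =
      coset X A p (\<lambda>x\<in>topspace X. f x + g x)"
    and "\<one>\<^bsub>residue_field X A p\<^esub> = coset X A p (\<lambda>x\<in>topspace X. 1)"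
    and "\<zero>\<^bsub>residue_field X A p\<^esub> = coset X A p (\<lambda>x\<in>topspace X. 0)"
proof -
  note hom = coset_ring_hom[OF A p]
  show "\<lbrakk>f \<in> A; g \<in> A\<rbrakk> \<Longrightarrow> coset X A p f \<otimes>\<^bsub>residue_field X A p\<^esub> coset X A p g =
      coset X A p (\<lambda>x\<in>topspace X. f x * g x)"
    using ring_hom_mult[OF hom, of f g] by simp
  show "\<lbrakk>f \<in> A; g \<in> A\<rbrakk> \<Longrightarrow> coset X A p f \<oplus>\<^bsub>residue_field X A p\<^esub> coset X A p g =
      coset X A p (\<lambda>x\<in>topspace X. f x + g x)"
    using ring_hom_add[OF hom, of f g] by simp
  show "\<one>\<^bsub>residue_field X A p\<^esub> = coset X A p (\<lambda>x\<in>topspace X. 1)"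
    using ring_hom_one[OF hom] by simp
  have "ring (residue_field X A p)"
    unfolding residue_field_def by (rule ideal.quotient_is_ring[OF max_ideal_ideal[OF A p]])
  then show "\<zero>\<^bsub>residue_field X A p\<^esub> = coset X A p (\<lambda>x\<in>topspace X. 0)"
    using ring_hom_zero[OF hom cring.axioms(1)[OF function_algebra_cring[OF A]]] by simp
qed

text \<open>By rigidity \<open>s\<close> fixes the constants, so $f - s(f)$ is in the kernel and therefore has value zero
  at \<open>p\<close>.\<close>

lemma real_character_imp_finite_values:
  assumes A: "function_algebra X A" and p: "p \<in> topspace (stone_cech X)"
    and add: "\<And>f g. \<lbrakk>f \<in> A; g \<in> A\<rbrakk> \<Longrightarrow> s (\<lambda>x\<in>topspace X. f x + g x) = (s f + s g :: real)"
    and mult: "\<And>f g. \<lbrakk>f \<in> A; g \<in> A\<rbrakk> \<Longrightarrow> s (\<lambda>x\<in>topspace X. f x * g x) = s f * s g"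
    and one: "s (\<lambda>x\<in>topspace X. 1) = 1"
    and ker: "\<And>f. \<lbrakk>f \<in> A; s f = 0\<rbrakk> \<Longrightarrow> f \<in> max_ideal X A p"
    and f: "f \<in> A"
  shows "finite_value X p f (s f)"
proof -
  note cA = function_algebraD(5)[OF A]
  have const: "s (\<lambda>x\<in>topspace X. c) = c" for c
  proof (rule real_endomorphism_id[where \<tau> = "\<lambda>c. s (\<lambda>x\<in>topspace X. c)"])
    show "s (\<lambda>x\<in>topspace X. a + b) = s (\<lambda>x\<in>topspace X. a) + s (\<lambda>x\<in>topspace X. b)" for a b
      using add[OF cA[of a] cA[of b]] by (simp cong: restrict_cong)
    show "s (\<lambda>x\<in>topspace X. a * b) = s (\<lambda>x\<in>topspace X. a) * s (\<lambda>x\<in>topspace X. b)" for a b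
      using mult[OF cA[of a] cA[of b]] by (simp cong: restrict_cong)
  qed (rule one)
  let ?g = "\<lambda>x\<in>topspace X. f x + (\<lambda>x\<in>topspace X. - s f) x"
  have "s ?g = 0" unfolding add[OF f cA] const by simp
  then have "?g \<in> max_ideal X A p" by (rule ker[OF function_algebraD(3)[OF A f cA]])
  then have "finite_value X p ?g 0" by (rule max_ideal_value_zero[OF A p])
  then have "finite_value X p (\<lambda>x\<in>topspace X. ?g x + (\<lambda>x\<in>topspace X. s f) x) (0 + s f)"
    by (intro finite_value_add[OF p] finite_value_const[OF p])
  moreover have "?g x + (\<lambda>x\<in>topspace X. s f) x = f x" if "x \<in> topspace X" for x
    using that by simp
  ultimately show ?thesis
    using finite_value_cong[of X "\<lambda>x\<in>topspace X. ?g x + (\<lambda>x\<in>topspace X. s f) x" f p "s f"] by simp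
qed

lemma real_ring_simps [simp]:
  "carrier real_ring = UNIV" "a \<otimes>\<^bsub>real_ring\<^esub> b = a * b" "a \<oplus>\<^bsub>real_ring\<^esub> b = a + b"
  "\<one>\<^bsub>real_ring\<^esub> = 1" "\<zero>\<^bsub>real_ring\<^esub> = 0"
  by (simp_all add: real_ring_def)

lemma ring_real_ring: "ring real_ring"
proof (rule ringI)
  show "abelian_group real_ring"
  proof (rule abelian_groupI)
    show "\<exists>b\<in>carrier real_ring. b \<oplus>\<^bsub>real_ring\<^esub> a = \<zero>\<^bsub>real_ring\<^esub>" for a
      by (rule bexI[where x = "- a"]) simp_all
  qed simp_all
  show "monoid real_ring" by (rule monoidI) simp_all
qed (simp_all add: algebra_simps)

text \<open>If all values are finite, evaluation at \<open>p\<close> is a homomorphism onto the reals whose kernel is the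
  maximal ideal. Conversely an isomorphism with the reals yields a real character to which
  \<open>real_character_imp_finite_values\<close> applies.\<close>

lemma residue_field_real_iff:
  assumes A: "function_algebra X A" and p: "p \<in> topspace (stone_cech X)"
  shows "residue_field X A p \<simeq> real_ring \<longleftrightarrow> (\<forall>f\<in>A. \<exists>a. finite_value X p f a)"
proof
  assume "residue_field X A p \<simeq> real_ring"
  then obtain \<phi> where "\<phi> \<in> ring_iso (residue_field X A p) real_ring"
    by (auto simp: is_ring_iso_def)
  then have hom: "\<phi> \<in> ring_hom (residue_field X A p) real_ring"
    and inj: "inj_on \<phi> (carrier (residue_field X A p))"
    by (auto simp: ring_iso_def bij_betw_def)
  define s where "s f = \<phi> (coset X A p f)" for f
  have car: "coset X A p f \<in> carrier (residue_field X A p)" if "f \<in> A" for f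
    using that by (simp add: residue_field_carrier)
  have add: "s (\<lambda>x\<in>topspace X. f x + g x) = s f + s g" if "f \<in> A" "g \<in> A" for f g
    using ring_hom_add[OF hom car[OF that(1)] car[OF that(2)]] coset_simps(2)[OF A p that]
    by (simp add: s_def)
  have "finite_value X p f (s f)" if "f \<in> A" for f
  proof (rule real_character_imp_finite_values[OF A p _ _ _ _ that])
    show "s (\<lambda>x\<in>topspace X. f x + g x) = s f + s g" if "f \<in> A" "g \<in> A" for f g
      by (rule add[OF that])
    show "s (\<lambda>x\<in>topspace X. f x * g x) = s f * s g" if "f \<in> A" "g \<in> A" for f g
      using ring_hom_mult[OF hom car[OF that(1)] car[OF that(2)]] coset_simps(1)[OF A p that]
      by (simp add: s_def)
    show "s (\<lambda>x\<in>topspace X. 1) = 1"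
      using ring_hom_one[OF hom] coset_simps(3)[OF A p] by (simp add: s_def)
    show "f \<in> max_ideal X A p" if f: "f \<in> A" and "s f = 0" for f
    proof -
      note zA = function_algebraD(5)[OF A, of 0]
      have "s (\<lambda>x\<in>topspace X. 0) = 0"
        using add[OF zA zA] by (simp cong: restrict_cong)
      then have "coset X A p f = coset X A p (\<lambda>x\<in>topspace X. 0)"
        using \<open>s f = 0\<close> by (intro inj_onD[OF inj] car f zA) (simp add: s_def)
      then have "(\<lambda>x\<in>topspace X. f x - (\<lambda>x\<in>topspace X. 0) x) \<in> max_ideal X A p"
        using coset_eq_iff[OF A p f zA] by blast
      then show ?thesis using function_algebra_restrict[OF A f] by (simp cong: restrict_cong)
    qed
  qed
  then show "\<forall>f\<in>A. \<exists>a. finite_value X p f a" by blast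
next
  assume fin: "\<forall>f\<in>A. \<exists>a. finite_value X p f a"
  define val where "val f = (THE a. finite_value X p f a)" for f
  have val_eq: "val f = a" if "finite_value X p f a" for f a
    unfolding val_def by (rule the_equality[where P = "finite_value X p f", OF that])
      (rule finite_value_unique[OF p _ that])
  have val: "finite_value X p f (val f)" if f: "f \<in> A" for f
  proof -
    obtain a where "finite_value X p f a" using fin f by blast
    then show ?thesis using val_eq[of f a] by simp
  qed
  have const: "val (\<lambda>x\<in>topspace X. c) = c" for c by (rule val_eq[OF finite_value_const[OF p]])
  have "val \<in> ring_hom (fun_ring X A) real_ring"
  proof (rule ring_hom_memI)
    show "val (f \<otimes>\<^bsub>fun_ring X A\<^esub> g) = val f \<otimes>\<^bsub>real_ring\<^esub> val g"
      if "f \<in> carrier (fun_ring X A)" "g \<in> carrier (fun_ring X A)" for f g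
      unfolding fun_ring_simps real_ring_simps
      by (intro val_eq finite_value_mult[OF p] val) (use that in simp_all)
    show "val (f \<oplus>\<^bsub>fun_ring X A\<^esub> g) = val f \<oplus>\<^bsub>real_ring\<^esub> val g"
      if "f \<in> carrier (fun_ring X A)" "g \<in> carrier (fun_ring X A)" for f g
      unfolding fun_ring_simps real_ring_simps
      by (intro val_eq finite_value_add[OF p] val) (use that in simp_all)
    show "val \<one>\<^bsub>fun_ring X A\<^esub> = \<one>\<^bsub>real_ring\<^esub>"
      unfolding fun_ring_simps real_ring_simps by (rule const)
  qed simp
  then have "ring_hom_ring (fun_ring X A) real_ring val"
    by (intro ring_hom_ringI2 ring_real_ring cring.axioms(1) function_algebra_cring[OF A])
  moreover have "val ` carrier (fun_ring X A) = carrier real_ring"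
  proof -
    have "c \<in> val ` A" for c
      using const[of c] function_algebraD(5)[OF A, of c] by (metis image_eqI)
    then show ?thesis unfolding fun_ring_simps real_ring_simps by blast
  qed
  ultimately have "fun_ring X A Quot a_kernel (fun_ring X A) real_ring val \<simeq> real_ring"
    by (rule ring_hom_ring.FactRing_iso)
  moreover have "a_kernel (fun_ring X A) real_ring val = max_ideal X A p"
  proof -
    have "val f = 0 \<longleftrightarrow> f \<in> max_ideal X A p" if f: "f \<in> A" for f
    proof
      assume zero: "val f = 0"
      have "finite_value X p (\<lambda>x\<in>topspace X. f x * g x) 0" if "g \<in> A" for g
        using finite_value_mult[OF p val[OF f] val[OF that]] by (simp add: zero)
      then show "f \<in> max_ideal X A p" using f by (simp add: max_ideal_iff[OF A p])
    next
      assume "f \<in> max_ideal X A p"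
      then show "val f = 0" by (intro val_eq max_ideal_value_zero[OF A p])
    qed
    then show ?thesis using max_ideal_subset[of X A p] by (auto simp: a_kernel_def')
  qed
  ultimately show "residue_field X A p \<simeq> real_ring" by (simp add: residue_field_def)
qed

lemma real_points_eq:
  assumes A: "function_algebra X A"
  shows "real_points X A = {p \<in> topspace (stone_cech X). \<forall>f\<in>A. \<exists>a. finite_value X p f a}"
  unfolding real_points_def using residue_field_real_iff[OF A] by blast

lemma nu_ring_eq:
  "nu_ring X A = {f \<in> cont_funs X. \<forall>p\<in>real_points X A. \<exists>a. finite_value X p f a}"
proof -
  have "sc_ext X f ` real_points X A \<subseteq> range Some \<longleftrightarrow>
      (\<forall>p\<in>real_points X A. \<exists>a. finite_value X p f a)" if f: "f \<in> cont_funs X" for f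
  proof -
    have "sc_ext X f p \<in> range Some \<longleftrightarrow> (\<exists>a. finite_value X p f a)" if "p \<in> real_points X A" for p
      using sc_ext_eq_Some_iff[OF f, of p] that by (auto simp: real_points_def image_iff)
    then show ?thesis by blast
  qed
  then show ?thesis unfolding nu_ring_def by blast
qed

lemma nu_ring_function_algebra: "function_algebra X (nu_ring X A)"
proof -
  have Y: "p \<in> topspace (stone_cech X)" if "p \<in> real_points X A" for p
    using that by (simp add: real_points_def)
  have C: "continuous_map X euclideanreal f" if "f \<in> nu_ring X A" for f
    using that by (simp add: nu_ring_eq cont_funs_continuous)
  show ?thesis
    unfolding function_algebra_def
  proof (intro conjI ballI)
    show "bdd_cont_funs X \<subseteq> nu_ring X A"
    proof
      fix f assume f: "f \<in> bdd_cont_funs X"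
      then show "f \<in> nu_ring X A"
        using finite_value_bdd[OF Y f] bdd_cont_funs_subset unfolding nu_ring_eq by blast
    qed
    show "nu_ring X A \<subseteq> cont_funs X" by (auto simp: nu_ring_eq)
    fix f g assume f: "f \<in> nu_ring X A" and g: "g \<in> nu_ring X A"
    have "\<exists>a. finite_value X p (\<lambda>x\<in>topspace X. f x + g x) a"
      "\<exists>a. finite_value X p (\<lambda>x\<in>topspace X. f x * g x) a" if p: "p \<in> real_points X A" for p
      using f g p finite_value_add[OF Y[OF p], of f _ g] finite_value_mult[OF Y[OF p], of f _ g]
      unfolding nu_ring_eq by blast+
    moreover have "(\<lambda>x\<in>topspace X. f x + g x) \<in> cont_funs X" "(\<lambda>x\<in>topspace X. f x * g x) \<in> cont_funs X"
      by (intro restrict_in_cont_funs continuous_map_add continuous_map_real_mult C f g)+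
    ultimately show "(\<lambda>x\<in>topspace X. f x + g x) \<in> nu_ring X A"
      "(\<lambda>x\<in>topspace X. f x * g x) \<in> nu_ring X A"
      by (simp_all add: nu_ring_eq)
  qed
qed

lemma subset_nu_ring:
  assumes "function_algebra X A"
  shows "A \<subseteq> nu_ring X A"
  using function_algebraD(2)[OF assms] by (auto simp: nu_ring_eq real_points_eq[OF assms])

lemma sc_embed_real_point:
  assumes A: "function_algebra X A" and x: "x \<in> topspace X"
  shows "sc_embed X x \<in> real_points X A"
  using sc_embed_in_stone_cech[OF x] finite_value_embed[OF function_algebraD(2)[OF A] x]
  by (auto simp: real_points_eq[OF A])

text \<open>A point outside $\upsilon_A(X)$ is detected by a member of \<open>A\<close> itself, which lies in $A^\nu(X)$.\<close>

lemma ex_infinite_value: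
  assumes A: "function_algebra X A" and p: "p \<in> topspace (stone_cech X) - real_points X A"
  shows "\<exists>f\<in>nu_ring X A. \<forall>a. \<not> finite_value X p f a"
  using p subset_nu_ring[OF A] by (auto simp: real_points_eq[OF A])

section \<open>Multipliers of free ideals\<close>

lemma finite_value_cancel:
  assumes p: "p \<in> topspace (stone_cech X)" and fg: "finite_value X p (\<lambda>x\<in>topspace X. f x * g x) c"
    and g: "finite_value X p g a" and a: "a \<noteq> 0"
  shows "finite_value X p f (c / a)"
proof -
  obtain w u where w: "w \<in> bdd_cont_funs X" "p w \<noteq> 0" "u \<in> bdd_cont_funs X" "p u = p w * a"
    "\<forall>x\<in>topspace X. u x = w x * g x" by (rule finite_valueE[OF g])
  obtain v t where v: "v \<in> bdd_cont_funs X" "p v \<noteq> 0" "t \<in> bdd_cont_funs X" "p t = p v * c"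
    "\<forall>x\<in>topspace X. t x = v x * (\<lambda>x\<in>topspace X. f x * g x) x" by (rule finite_valueE[OF fg])
  show ?thesis
  proof (rule finite_valueI)
    show "(\<lambda>x\<in>topspace X. u x * v x) \<in> bdd_cont_funs X" by (rule bdd_mult[OF w(3) v(1)])
    show "p (\<lambda>x\<in>topspace X. u x * v x) \<noteq> 0"
      using stone_cech_mult[OF w(3) v(1) p] w v a by simp
    show "(\<lambda>x\<in>topspace X. w x * t x) \<in> bdd_cont_funs X" by (rule bdd_mult[OF w(1) v(3)])
    show "p (\<lambda>x\<in>topspace X. w x * t x) = p (\<lambda>x\<in>topspace X. u x * v x) * (c / a)"
      unfolding stone_cech_mult[OF w(1) v(3) p] stone_cech_mult[OF w(3) v(1) p] w(4) v(4)
      using a by simp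
    show "\<forall>x\<in>topspace X. (\<lambda>x\<in>topspace X. w x * t x) x = (\<lambda>x\<in>topspace X. u x * v x) x * f x"
      using w(5) v(5) by simp
  qed
qed

text \<open>For an ideal of $A^\nu(X)$ and the set of real points, where all its members have finite values,
  this says that the ideal has no common zero.\<close>

definition free_on :: "'a topology \<Rightarrow> (('a \<Rightarrow> real) \<Rightarrow> real) set \<Rightarrow> ('a \<Rightarrow> real) set \<Rightarrow> bool" where
  "free_on X Y Q \<longleftrightarrow> (\<forall>y\<in>Y. \<exists>g\<in>Q. \<exists>a. finite_value X y g a \<and> a \<noteq> 0)"

lemma free_on_nonvanishing:
  assumes A: "function_algebra X A" and Q: "Q \<subseteq> nu_ring X A"
    and free: "free_on X (real_points X A) Q" and x: "x \<in> topspace X"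
  shows "\<exists>g\<in>Q. g x \<noteq> 0"
proof -
  obtain g a where g: "g \<in> Q" "finite_value X (sc_embed X x) g a" "a \<noteq> 0"
    using free sc_embed_real_point[OF A x] unfolding free_on_def by blast
  have "g \<in> cont_funs X" using g(1) Q function_algebraD(2)[OF nu_ring_function_algebra] by blast
  then have "a = g x"
    by (intro finite_value_unique[OF sc_embed_in_stone_cech[OF x] g(2)] finite_value_embed x)
  then show ?thesis using g by blast
qed

lemma free_on_cancel:
  assumes A: "function_algebra X A" and Q: "Q \<subseteq> nu_ring X A"
    and free: "free_on X (real_points X A) Q"
    and f: "f \<in> cont_funs X" and g: "g \<in> cont_funs X"
    and eq: "\<And>m x. \<lbrakk>m \<in> Q; x \<in> topspace X\<rbrakk> \<Longrightarrow> f x * m x = g x * m x"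
  shows "f = g"
proof (rule cont_funs_eqI[OF f g])
  fix x assume x: "x \<in> topspace X"
  obtain m where "m \<in> Q" "m x \<noteq> 0" using free_on_nonvanishing[OF A Q free x] by blast
  then show "f x = g x" using eq[of m x] x by simp
qed

text \<open>A map \<open>T\<close> that is linear over the functions it acts on is locally multiplication by $T(g)/g$, and
  linearity, in the form of the commutation hypothesis, makes these quotients agree where they are
  both defined. Freeness at the points of \<open>X\<close> glues them to a continuous function, and freeness at
  all real points makes that function finite there, so that it belongs to $A^\nu(X)$.\<close>

lemma multiplier_exists:
  assumes A: "function_algebra X A" and Q: "Q \<subseteq> nu_ring X A"
    and free: "free_on X (real_points X A) Q"
    and T: "\<And>g. g \<in> Q \<Longrightarrow> T g \<in> nu_ring X A"
    and comm: "\<And>g h x. \<lbrakk>g \<in> Q; h \<in> Q; x \<in> topspace X\<rbrakk> \<Longrightarrow> T g x * h x = T h x * g x"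
  shows "\<exists>f\<in>nu_ring X A. \<forall>g\<in>Q. T g = (\<lambda>x\<in>topspace X. f x * g x)"
proof -
  let ?N = "nu_ring X A"
  have C: "f \<in> cont_funs X" if "f \<in> ?N" for f
    using that function_algebraD(2)[OF nu_ring_function_algebra] by blast
  have "\<forall>x\<in>topspace X. \<exists>g\<in>Q. g x \<noteq> 0"
    using free_on_nonvanishing[OF A Q free] by blast
  then obtain G where G: "\<And>x. x \<in> topspace X \<Longrightarrow> G x \<in> Q" "\<And>x. x \<in> topspace X \<Longrightarrow> G x x \<noteq> 0"
    by metis
  define f where "f = (\<lambda>x\<in>topspace X. T (G x) x / G x x)"
  have f_mult: "f x * g x = T g x" if "g \<in> Q" and x: "x \<in> topspace X" for g x
    using comm[OF that(1) G(1)[OF x] x] G(2)[OF x] x by (simp add: f_def divide_eq_eq)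
  have T_eq: "T g = (\<lambda>x\<in>topspace X. f x * g x)" if g: "g \<in> Q" for g
  proof -
    have "T g = (\<lambda>x\<in>topspace X. T g x)" by (rule cont_funs_restrict[OF C[OF T[OF g]], symmetric])
    also have "\<dots> = (\<lambda>x\<in>topspace X. f x * g x)" by (rule restrict_ext) (rule f_mult[OF g, symmetric])
    finally show ?thesis .
  qed
  have "continuous_map X euclideanreal f"
  proof (rule pasting_lemma[where I = Q and T = "\<lambda>g. {x \<in> topspace X. g x \<in> UNIV - {0}}"
        and f = "\<lambda>g x. T g x / g x"])
    fix g assume g: "g \<in> Q"
    have cg: "continuous_map X euclideanreal g" and cT: "continuous_map X euclideanreal (T g)"
      using C T[OF g] g Q by (auto intro: cont_funs_continuous)
    show "openin X {x \<in> topspace X. g x \<in> UNIV - {0}}"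
      by (rule openin_continuous_map_preimage[OF cg]) auto
    show "continuous_map (subtopology X {x \<in> topspace X. g x \<in> UNIV - {0}}) euclideanreal
        (\<lambda>x. T g x / g x)"
      by (intro continuous_map_real_divide continuous_map_from_subtopology cg cT) simp
  next
    fix g h x assume "g \<in> Q" "h \<in> Q"
      "x \<in> topspace X \<inter> {x \<in> topspace X. g x \<in> UNIV - {0}} \<inter> {x \<in> topspace X. h x \<in> UNIV - {0}}"
    then show "T g x / g x = T h x / h x" using comm[of g h x] by (simp add: frac_eq_eq)
  next
    fix x assume x: "x \<in> topspace X"
    show "\<exists>g. g \<in> Q \<and> x \<in> {x \<in> topspace X. g x \<in> UNIV - {0}} \<and> f x = T g x / g x"
      using G[OF x] x by (intro exI[where x = "G x"]) (simp add: f_def)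
  qed
  moreover have "f \<in> extensional (topspace X)" by (simp add: f_def)
  ultimately have "f \<in> cont_funs X" by (simp add: cont_funs_def)
  moreover have "\<exists>a. finite_value X y f a" if y: "y \<in> real_points X A" for y
  proof -
    obtain g a where g: "g \<in> Q" "finite_value X y g a" "a \<noteq> 0"
      using free y unfolding free_on_def by blast
    obtain c where "finite_value X y (T g) c"
      using T[OF g(1)] y unfolding nu_ring_eq by blast
    then have "finite_value X y f (c / a)"
      unfolding T_eq[OF g(1)]
      by (rule finite_value_cancel[rotated, OF _ g(2,3)]) (use y in \<open>simp add: real_points_def\<close>)
    then show ?thesis ..
  qed
  ultimately have "f \<in> ?N" by (simp add: nu_ring_eq)
  then show ?thesis using T_eq by blast
qed

lemma theta_eq_coset: "theta X A p = coset X (nu_ring X A) p"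
  by (rule ext) (simp add: theta_def coset_def)

section \<open>The subring determined by a subfield of a residue field\<close>

text \<open>The ring \<open>B\<close> sits between the maximal ideal \<open>M\<close> of \<open>N\<close> and \<open>N\<close> itself. It shares the ideal \<open>M\<close>
  with \<open>N\<close>, and \<open>M\<close> is maximal in \<open>B\<close> too, the quotient being the field \<open>F\<close>. Since \<open>F\<close> need not
  contain the reals, \<open>B\<close> need not contain the constant functions.\<close>

locale residue_subring =
  fixes X :: "'a topology" and A :: "('a \<Rightarrow> real) set" and p :: "('a \<Rightarrow> real) \<Rightarrow> real"
    and F :: "('a \<Rightarrow> real) set set"
  assumes algebra: "function_algebra X A"
    and not_real: "p \<in> topspace (stone_cech X) - real_points X A"
    and F: "subfield F (residue_field X (nu_ring X A) p)"
begin

abbreviation "N \<equiv> nu_ring X A"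
abbreviation "M \<equiv> max_ideal X N p"
abbreviation "B \<equiv> B_ring X A p F"
abbreviation "K \<equiv> residue_field X N p"
abbreviation "\<theta> \<equiv> coset X N p"

lemma p: "p \<in> topspace (stone_cech X)"
  using not_real by blast

lemmas N_algebra = nu_ring_function_algebra[of X A]
lemmas N_cont = function_algebraD(2)[OF N_algebra]
lemmas N_add = function_algebraD(3)[OF N_algebra]
lemmas N_mult = function_algebraD(4)[OF N_algebra]
lemmas N_const = function_algebraD(5)[OF N_algebra]
lemmas M_mult = max_ideal_mult[OF N_algebra p]
lemmas \<theta>_eq_iff = coset_eq_iff[OF N_algebra p]
lemmas \<theta>_simps = coset_simps[OF N_algebra p]

lemma N_restrict: "f \<in> N \<Longrightarrow> (\<lambda>x\<in>topspace X. f x) = f"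
  by (rule cont_funs_restrict[OF N_cont])

lemma M_subset_N: "m \<in> M \<Longrightarrow> m \<in> N"
  using max_ideal_subset by blast

lemma B_iff: "f \<in> B \<longleftrightarrow> f \<in> N \<and> \<theta> f \<in> F"
  by (simp add: B_ring_def theta_eq_coset)

lemma B_subset_N: "f \<in> B \<Longrightarrow> f \<in> N"
  by (simp add: B_iff)

lemmas F_subring = subfieldE(1)[OF F]

lemma K_ring: "ring K"
  unfolding residue_field_def by (rule ideal.quotient_is_ring[OF max_ideal_ideal[OF N_algebra p]])

lemma B_add: "\<lbrakk>f \<in> B; g \<in> B\<rbrakk> \<Longrightarrow> (\<lambda>x\<in>topspace X. f x + g x) \<in> B"
  using subringE(7)[OF F_subring, of "\<theta> f" "\<theta> g"] by (simp add: B_iff \<theta>_simps N_add)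

lemma B_mult: "\<lbrakk>f \<in> B; g \<in> B\<rbrakk> \<Longrightarrow> (\<lambda>x\<in>topspace X. f x * g x) \<in> B"
  using subringE(6)[OF F_subring, of "\<theta> f" "\<theta> g"] by (simp add: B_iff \<theta>_simps N_mult)

lemma B_one: "(\<lambda>x\<in>topspace X. 1) \<in> B"
  using subringE(3)[OF F_subring] unfolding B_iff \<theta>_simps(3) by (simp only: N_const simp_thms)

lemma B_minus_one: "(\<lambda>x\<in>topspace X. - 1) \<in> B"
proof -
  have car: "\<theta> f \<in> carrier K" if "f \<in> N" for f
    using that by (simp add: residue_field_carrier)
  have "\<theta> (\<lambda>x\<in>topspace X. - 1) \<oplus>\<^bsub>K\<^esub> \<theta> (\<lambda>x\<in>topspace X. 1) = \<zero>\<^bsub>K\<^esub>"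
    unfolding \<theta>_simps(2)[OF N_const N_const] \<theta>_simps(4) by (simp cong: restrict_cong)
  then have "\<ominus>\<^bsub>K\<^esub> \<theta> (\<lambda>x\<in>topspace X. 1) = \<theta> (\<lambda>x\<in>topspace X. - 1)"
    by (rule abelian_group.minus_equality[OF ring.is_abelian_group[OF K_ring] _ car[OF N_const] car[OF N_const]])
  then show ?thesis
    using subringE(5)[OF F_subring subringE(3)[OF F_subring]] N_const[of "- 1"]
    unfolding B_iff \<theta>_simps(3) by simp
qed

lemma B_diff:
  assumes "f \<in> B" "g \<in> B" shows "(\<lambda>x\<in>topspace X. f x - g x) \<in> B"
proof -
  have "(\<lambda>x\<in>topspace X. f x + (\<lambda>x\<in>topspace X. (\<lambda>x\<in>topspace X. - 1) x * g x) x) \<in> B"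
    by (intro B_add B_mult B_minus_one assms)
  then show ?thesis by (simp cong: restrict_cong)
qed

lemma \<theta>_zero_iff: "f \<in> N \<Longrightarrow> \<theta> f = \<zero>\<^bsub>K\<^esub> \<longleftrightarrow> f \<in> M"
  unfolding \<theta>_simps(4) by (subst \<theta>_eq_iff[OF _ N_const]) (simp_all add: N_restrict cong: restrict_cong)

lemma M_subset_B: "m \<in> M \<Longrightarrow> m \<in> B"
  using subringE(2)[OF F_subring] \<theta>_zero_iff[of m] M_subset_N[of m] by (simp add: B_iff)

lemma F_eq: "F = \<theta> ` B"
  using subfieldE(3)[OF F] by (auto simp: B_iff residue_field_carrier)

text \<open>This is the maximality of \<open>M\<close> in \<open>B\<close>: modulo \<open>M\<close>, every other element has an inverse in the
  field \<open>F\<close>.\<close>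

lemma B_inverse:
  assumes f: "f \<in> B" "f \<notin> M"
  shows "\<exists>b\<in>B. (\<lambda>x\<in>topspace X. b x * f x - 1) \<in> M"
proof -
  have "\<theta> f \<in> F - {\<zero>\<^bsub>K\<^esub>}" using f \<theta>_zero_iff[of f] by (simp add: B_iff)
  note inv = ring.subfield_m_inv[OF K_ring F this]
  obtain b where b: "b \<in> B" "inv\<^bsub>K\<^esub> \<theta> f = \<theta> b" using inv(1) F_eq by blast
  have "\<theta> (\<lambda>x\<in>topspace X. b x * f x) = \<theta> (\<lambda>x\<in>topspace X. 1)"
    using inv(3) \<theta>_simps(1)[OF B_subset_N[OF b(1)] B_subset_N[OF f(1)]]
    unfolding b(2) \<theta>_simps(3) by simp
  then have "(\<lambda>x\<in>topspace X. (\<lambda>x\<in>topspace X. b x * f x) x - (\<lambda>x\<in>topspace X. 1) x) \<in> M"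
    using \<theta>_eq_iff[OF N_mult[OF B_subset_N[OF b(1)] B_subset_N[OF f(1)]] N_const] by blast
  then show ?thesis using b(1) by (intro bexI[where x = b]) (simp_all cong: restrict_cong)
qed

lemma one_notin_M: "(\<lambda>x\<in>topspace X. 1) \<notin> M"
proof
  assume "(\<lambda>x\<in>topspace X. 1) \<in> M"
  then have "finite_value X p (\<lambda>x\<in>topspace X. 1) 0" by (rule max_ideal_value_zero[OF N_algebra p])
  then show False using finite_value_unique[OF p _ finite_value_const[OF p, of 1]] by fastforce
qed

text \<open>Here it matters that \<open>p\<close> is not a real point: a real point differs from \<open>p\<close> and is separated from
  it by a bounded function in \<open>M\<close>.\<close>

lemma M_free: "free_on X (real_points X A) M"
  unfolding free_on_def
proof
  fix y assume y: "y \<in> real_points X A"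
  then have yS: "y \<in> topspace (stone_cech X)" by (simp add: real_points_def)
  have "y \<noteq> p" using y not_real by blast
  then obtain g where "g \<in> bdd_cont_funs X" "g \<in> M" "y g \<noteq> 0"
    using max_ideal_separates[OF N_algebra p yS] by blast
  then show "\<exists>g\<in>M. \<exists>a. finite_value X y g a \<and> a \<noteq> 0"
    using finite_value_bdd[OF yS] by blast
qed

end

section \<open>Isomorphisms between such subrings\<close>

definition pointwise_iso ::
    "'a topology \<Rightarrow> ('a \<Rightarrow> real) set \<Rightarrow> ('a \<Rightarrow> real) set \<Rightarrow> (('a \<Rightarrow> real) \<Rightarrow> ('a \<Rightarrow> real)) \<Rightarrow> bool"
  where "pointwise_iso X B C \<phi> \<longleftrightarrow> bij_betw \<phi> B C \<and>
    (\<forall>f\<in>B. \<forall>g\<in>B. \<phi> (\<lambda>x\<in>topspace X. f x + g x) = (\<lambda>x\<in>topspace X. \<phi> f x + \<phi> g x) \<and>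
      \<phi> (\<lambda>x\<in>topspace X. f x * g x) = (\<lambda>x\<in>topspace X. \<phi> f x * \<phi> g x)) \<and>
    \<phi> (\<lambda>x\<in>topspace X. 1) = (\<lambda>x\<in>topspace X. 1)"

lemma pointwise_iso_iff_ring_iso:
  "pointwise_iso X B C \<phi> \<longleftrightarrow> \<phi> \<in> ring_iso (fun_ring X B) (fun_ring X C)"
  unfolding pointwise_iso_def ring_iso_def ring_hom_def
  by (auto simp: bij_betw_def)

lemma pointwise_isoD:
  assumes "pointwise_iso X B C \<phi>"
  shows "f \<in> B \<Longrightarrow> \<phi> f \<in> C"
    and "\<lbrakk>f \<in> B; g \<in> B\<rbrakk> \<Longrightarrow> \<phi> (\<lambda>x\<in>topspace X. f x + g x) = (\<lambda>x\<in>topspace X. \<phi> f x + \<phi> g x)"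
    and "\<lbrakk>f \<in> B; g \<in> B\<rbrakk> \<Longrightarrow> \<phi> (\<lambda>x\<in>topspace X. f x * g x) = (\<lambda>x\<in>topspace X. \<phi> f x * \<phi> g x)"
    and "\<phi> (\<lambda>x\<in>topspace X. 1) = (\<lambda>x\<in>topspace X. 1)"
    and "\<lbrakk>f \<in> B; g \<in> B; \<phi> f = \<phi> g\<rbrakk> \<Longrightarrow> f = g"
    and "\<phi> ` B = C"
  using assms by (auto simp: pointwise_iso_def bij_betw_def dest: inj_onD)

lemma pointwise_iso_inverse:
  assumes iso: "pointwise_iso X B C \<phi>"
    and add: "\<And>f g. \<lbrakk>f \<in> B; g \<in> B\<rbrakk> \<Longrightarrow> (\<lambda>x\<in>topspace X. f x + g x) \<in> B"
    and mult: "\<And>f g. \<lbrakk>f \<in> B; g \<in> B\<rbrakk> \<Longrightarrow> (\<lambda>x\<in>topspace X. f x * g x) \<in> B"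
    and one: "(\<lambda>x\<in>topspace X. 1) \<in> B"
  shows "pointwise_iso X C B (inv_into B \<phi>)"
proof -
  let ?\<iota> = "inv_into B \<phi>"
  note \<phi> = pointwise_isoD[OF iso]
  have bij: "bij_betw \<phi> B C" using iso by (simp add: pointwise_iso_def)
  have \<iota>: "?\<iota> g \<in> B" "\<phi> (?\<iota> g) = g" if "g \<in> C" for g
    using that bij by (auto simp: bij_betw_def inv_into_into f_inv_into_f)
  have \<iota>_eq: "?\<iota> g = f" if "f \<in> B" "\<phi> f = g" for f g
    using bij that by (auto simp: bij_betw_def)
  show ?thesis
    unfolding pointwise_iso_def
  proof (intro conjI ballI)
    show "bij_betw ?\<iota> C B" by (rule bij_betw_inv_into[OF bij])
    show "?\<iota> (\<lambda>x\<in>topspace X. 1) = (\<lambda>x\<in>topspace X. 1)" by (rule \<iota>_eq[OF one \<phi>(4)])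
    fix f g assume fg: "f \<in> C" "g \<in> C"
    show "?\<iota> (\<lambda>x\<in>topspace X. f x + g x) = (\<lambda>x\<in>topspace X. ?\<iota> f x + ?\<iota> g x)"
      by (rule \<iota>_eq[OF add[OF \<iota>(1)[OF fg(1)] \<iota>(1)[OF fg(2)]]])
        (simp only: \<phi>(2)[OF \<iota>(1)[OF fg(1)] \<iota>(1)[OF fg(2)]] \<iota>(2)[OF fg(1)] \<iota>(2)[OF fg(2)])
    show "?\<iota> (\<lambda>x\<in>topspace X. f x * g x) = (\<lambda>x\<in>topspace X. ?\<iota> f x * ?\<iota> g x)"
      by (rule \<iota>_eq[OF mult[OF \<iota>(1)[OF fg(1)] \<iota>(1)[OF fg(2)]]])
        (simp only: \<phi>(3)[OF \<iota>(1)[OF fg(1)] \<iota>(1)[OF fg(2)]] \<iota>(2)[OF fg(1)] \<iota>(2)[OF fg(2)])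
  qed
qed

locale residue_subring_iso =
  P: residue_subring X A p F + Q: residue_subring X A q F'
  for X :: "'a topology" and A :: "('a \<Rightarrow> real) set" and p q :: "('a \<Rightarrow> real) \<Rightarrow> real"
    and F F' :: "('a \<Rightarrow> real) set set" +
  fixes \<phi> :: "('a \<Rightarrow> real) \<Rightarrow> ('a \<Rightarrow> real)"
  assumes iso: "pointwise_iso X P.B Q.B \<phi>"
begin

lemmas \<phi> = pointwise_isoD[OF iso]

lemma \<phi>_diff:
  assumes f: "f \<in> P.B" and g: "g \<in> P.B"
  shows "\<phi> (\<lambda>x\<in>topspace X. f x - g x) = (\<lambda>x\<in>topspace X. \<phi> f x - \<phi> g x)"
proof -
  let ?d = "\<lambda>x\<in>topspace X. f x - g x"
  have d: "?d \<in> P.B" by (rule P.B_diff[OF f g])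
  have "(\<lambda>x\<in>topspace X. ?d x + g x) = f"
    using P.N_restrict[OF P.B_subset_N[OF f]] by (simp cong: restrict_cong)
  then have "\<phi> f = (\<lambda>x\<in>topspace X. \<phi> ?d x + \<phi> g x)" using \<phi>(2)[OF d g] by simp
  then have "(\<lambda>x\<in>topspace X. \<phi> f x - \<phi> g x) = (\<lambda>x\<in>topspace X. \<phi> ?d x)"
    by (intro restrict_ext) simp
  then show ?thesis using P.N_restrict[OF Q.B_subset_N[OF \<phi>(1)[OF d]]] by simp
qed

lemma inverse: "residue_subring_iso X A q p F' F (inv_into P.B \<phi>)"
  by (unfold_locales) (rule pointwise_iso_inverse[OF iso P.B_add P.B_mult P.B_one])

lemma \<phi>_inv: "g \<in> Q.B \<Longrightarrow> inv_into P.B \<phi> g \<in> P.B" "g \<in> Q.B \<Longrightarrow> \<phi> (inv_into P.B \<phi> g) = g"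
  using \<phi>(6) by (auto simp: inv_into_into f_inv_into_f)

lemma inv_\<phi>: "f \<in> P.B \<Longrightarrow> inv_into P.B \<phi> (\<phi> f) = f"
  using \<phi>(5) by (intro inv_into_f_f inj_onI) auto

text \<open>Multiplication by \<open>f\<close> preserves the ideal \<open>M\<close> of \<open>P.B\<close> even if \<open>f\<close> is not in \<open>P.B\<close>. Carried over
  by \<open>\<phi>\<close>, it becomes a linear map of the ideal \<open>\<phi> ` P.M\<close> into \<open>Q.B\<close>, which is multiplication by
  some \<open>f'\<close> as soon as this ideal is free.\<close>

lemma conductor_multiplier:
  assumes f: "f \<in> P.N" and free: "free_on X (real_points X A) (\<phi> ` P.M)"
  shows "\<exists>f'\<in>P.N. \<forall>m\<in>P.M. \<phi> (\<lambda>x\<in>topspace X. f x * m x) = (\<lambda>x\<in>topspace X. f' x * \<phi> m x)"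
proof -
  let ?\<iota> = "inv_into P.B \<phi>"
  define T where "T g = \<phi> (\<lambda>x\<in>topspace X. f x * ?\<iota> g x)" for g
  have fm: "(\<lambda>x\<in>topspace X. f x * m x) \<in> P.B" if "m \<in> P.M" for m
    using P.M_subset_B[OF P.M_mult[OF that f]] by (simp only: mult.commute)
  have T: "T (\<phi> m) = \<phi> (\<lambda>x\<in>topspace X. f x * m x)" if "m \<in> P.M" for m
    unfolding T_def inv_\<phi>[OF P.M_subset_B[OF that]] ..
  have "\<exists>f'\<in>P.N. \<forall>g\<in>\<phi> ` P.M. T g = (\<lambda>x\<in>topspace X. f' x * g x)"
  proof (rule multiplier_exists[OF P.algebra _ free])
    show "\<phi> ` P.M \<subseteq> P.N"
      using Q.B_subset_N[OF \<phi>(1)[OF P.M_subset_B]] by (rule image_subsetI)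
    fix g assume "g \<in> \<phi> ` P.M"
    then obtain m where g: "g = \<phi> m" "m \<in> P.M" by (rule imageE)
    show "T g \<in> P.N" unfolding g(1) T[OF g(2)] by (rule Q.B_subset_N[OF \<phi>(1)[OF fm[OF g(2)]]])
    fix h x assume "h \<in> \<phi> ` P.M" and x: "x \<in> topspace X"
    then obtain n where h: "h = \<phi> n" "n \<in> P.M" by (auto elim: imageE)
    note mB = P.M_subset_B[OF g(2)] and nB = P.M_subset_B[OF h(2)]
    have "(\<lambda>x\<in>topspace X. (\<lambda>x\<in>topspace X. f x * m x) x * n x) =
        (\<lambda>x\<in>topspace X. (\<lambda>x\<in>topspace X. f x * n x) x * m x)"
      by (rule restrict_ext) simp
    from arg_cong[OF this, of \<phi>]
    have "(\<lambda>x\<in>topspace X. T g x * h x) = (\<lambda>x\<in>topspace X. T h x * g x)"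
      unfolding g(1) h(1) T[OF g(2)] T[OF h(2)] \<phi>(3)[OF fm[OF g(2)] nB] \<phi>(3)[OF fm[OF h(2)] mB] .
    from fun_cong[OF this, of x] show "T g x * h x = T h x * g x" using x by simp
  qed
  then obtain f' where "f' \<in> P.N" "\<And>m. m \<in> P.M \<Longrightarrow> T (\<phi> m) = (\<lambda>x\<in>topspace X. f' x * \<phi> m x)"
    by blast
  then show ?thesis using T by auto
qed

lemma image_mult:
  assumes g: "g \<in> \<phi> ` P.M" and b: "b \<in> Q.B"
  shows "(\<lambda>x\<in>topspace X. b x * g x) \<in> \<phi> ` P.M"
proof -
  obtain m where m: "g = \<phi> m" "m \<in> P.M" using g by (rule imageE)
  obtain a where a: "b = \<phi> a" "a \<in> P.B" using b \<phi>(6) by blast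
  have "(\<lambda>x\<in>topspace X. m x * a x) \<in> P.M" by (rule P.M_mult[OF m(2) P.B_subset_N[OF a(2)]])
  then have "\<phi> (\<lambda>x\<in>topspace X. m x * a x) \<in> \<phi> ` P.M" by (rule imageI)
  then show ?thesis
    unfolding \<phi>(3)[OF P.M_subset_B[OF m(2)] a(2)] m(1) a(1) by (simp only: mult.commute)
qed

lemma image_inverse:
  assumes f: "f \<in> Q.B" "f \<notin> \<phi> ` P.M"
  shows "\<exists>b\<in>Q.B. (\<lambda>x\<in>topspace X. b x * f x - 1) \<in> \<phi> ` P.M"
proof -
  obtain a where a: "f = \<phi> a" "a \<in> P.B" using f(1) \<phi>(6) by blast
  have "a \<notin> P.M" using f(2) a(1) by blast
  from P.B_inverse[OF a(2) this] obtain b where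
    b: "b \<in> P.B" "(\<lambda>x\<in>topspace X. b x * a x - 1) \<in> P.M" by blast
  have "(\<lambda>x\<in>topspace X. (\<lambda>x\<in>topspace X. b x * a x) x - (\<lambda>x\<in>topspace X. 1) x) \<in> P.M"
    using b(2) by (simp cong: restrict_cong)
  then have "\<phi> (\<lambda>x\<in>topspace X. (\<lambda>x\<in>topspace X. b x * a x) x - (\<lambda>x\<in>topspace X. 1) x) \<in> \<phi> ` P.M"
    by (rule imageI)
  then have "(\<lambda>x\<in>topspace X. \<phi> b x * f x - 1) \<in> \<phi> ` P.M"
    unfolding \<phi>_diff[OF P.B_mult[OF b(1) a(2)] P.B_one] \<phi>(3)[OF b(1) a(2)] \<phi>(4) a(1)
    by (simp cong: restrict_cong)
  then show ?thesis using \<phi>(1)[OF b(1)] by blast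
qed

lemma image_proper: "(\<lambda>x\<in>topspace X. 1) \<notin> \<phi> ` P.M"
proof
  assume "(\<lambda>x\<in>topspace X. 1) \<in> \<phi> ` P.M"
  then obtain m where m: "(\<lambda>x\<in>topspace X. 1) = \<phi> m" "m \<in> P.M" by (rule imageE)
  have "(\<lambda>x\<in>topspace X. 1) = m"
    by (rule \<phi>(5)[OF P.B_one P.M_subset_B[OF m(2)]]) (rule trans[OF \<phi>(4) m(1)])
  then show False using P.one_notin_M m(2) by simp
qed

text \<open>Both ideals are maximal in \<open>Q.B\<close>, so two different ones generate the unit ideal.\<close>

lemma comaximal:
  assumes neq: "\<phi> ` P.M \<noteq> Q.M"
  shows "\<exists>g\<in>\<phi> ` P.M. \<exists>m\<in>Q.M. \<forall>x\<in>topspace X. g x + m x = 1"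
proof -
  \<comment> \<open>A strictly larger ideal than \<open>Q.M\<close> would contain a unit modulo \<open>Q.M\<close>, hence the constant 1.\<close>
  have "\<not> Q.M \<subseteq> \<phi> ` P.M"
  proof
    assume sub: "Q.M \<subseteq> \<phi> ` P.M"
    then obtain g where g: "g \<in> \<phi> ` P.M" "g \<notin> Q.M" using neq by blast
    have gB: "g \<in> Q.B" using g(1) \<phi>(1)[OF P.M_subset_B] by blast
    obtain b where b: "b \<in> Q.B" "(\<lambda>x\<in>topspace X. b x * g x - 1) \<in> Q.M"
      using Q.B_inverse[OF gB g(2)] by blast
    obtain m where m: "(\<lambda>x\<in>topspace X. b x * g x) = \<phi> m" "m \<in> P.M"
      using image_mult[OF g(1) b(1)] by (rule imageE)
    obtain n where n: "(\<lambda>x\<in>topspace X. b x * g x - 1) = \<phi> n" "n \<in> P.M"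
      using b(2) sub by blast
    have mn: "(\<lambda>x\<in>topspace X. m x - n x) \<in> P.M"
    proof -
      have "(\<lambda>x\<in>topspace X. m x + (\<lambda>x\<in>topspace X. n x * (\<lambda>x\<in>topspace X. - 1) x) x) \<in> P.M"
        by (intro max_ideal_add[OF P.N_algebra P.p] m(2) P.M_mult n(2) P.N_const)
      then show ?thesis by (simp cong: restrict_cong)
    qed
    have "\<phi> (\<lambda>x\<in>topspace X. m x - n x) = (\<lambda>x\<in>topspace X. 1)"
      unfolding \<phi>_diff[OF P.M_subset_B[OF m(2)] P.M_subset_B[OF n(2)]] m(1)[symmetric] n(1)[symmetric]
      by (simp cong: restrict_cong)
    then show False using image_proper imageI[OF mn, of \<phi>] by simp
  qed
  then obtain m where m: "m \<in> Q.M" "m \<notin> \<phi> ` P.M" by blast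
  obtain b where b: "b \<in> Q.B" "(\<lambda>x\<in>topspace X. b x * m x - 1) \<in> \<phi> ` P.M"
    using image_inverse[OF Q.M_subset_B[OF m(1)] m(2)] by blast
  have "(\<lambda>x\<in>topspace X. (\<lambda>x\<in>topspace X. - 1) x * (\<lambda>x\<in>topspace X. b x * m x - 1) x) \<in> \<phi> ` P.M"
    by (rule image_mult[OF b(2) Q.B_minus_one])
  moreover have "(\<lambda>x\<in>topspace X. m x * b x) \<in> Q.M"
    by (rule Q.M_mult[OF m(1) Q.B_subset_N[OF b(1)]])
  ultimately show ?thesis
  proof (intro bexI ballI)
    show "(\<lambda>x\<in>topspace X. (\<lambda>x\<in>topspace X. - 1) x * (\<lambda>x\<in>topspace X. b x * m x - 1) x) x +
        (\<lambda>x\<in>topspace X. m x * b x) x = 1" if "x \<in> topspace X" for x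
      using that by simp
  qed
qed

text \<open>Suppose that the ideal \<open>\<phi> ` P.M\<close> vanishes at a real point \<open>y\<close>. Then evaluation at \<open>y\<close> after \<open>\<phi>\<close>
  factors through the field \<open>F\<close>. Because \<open>F\<close> is a copy of the whole residue field, this gives a
  real-valued character of \<open>P.N\<close> whose kernel lies in \<open>P.M\<close>, and then all members of \<open>P.N\<close> have
  finite values at \<open>p\<close>, although \<open>p\<close> is not a real point.\<close>

lemma image_free:
  assumes \<sigma>: "\<sigma> \<in> ring_iso (P.K\<lparr>carrier := F\<rparr>) P.K"
  shows "free_on X (real_points X A) (\<phi> ` P.M)"
proof (rule ccontr)
  assume "\<not> ?thesis"
  then obtain y where y: "y \<in> real_points X A"
    and fixed: "\<And>g a. \<lbrakk>g \<in> \<phi> ` P.M; finite_value X y g a\<rbrakk> \<Longrightarrow> a = 0"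
    unfolding free_on_def by blast
  have yS: "y \<in> topspace (stone_cech X)" using y by (simp add: real_points_def)
  note \<sigma>' = ring_iso_memE[OF \<sigma>, simplified]
  \<comment> \<open>Elements of \<open>P.B\<close> that represent the class of \<open>f\<close>, when \<open>F\<close> is identified with the whole
    residue field.\<close>
  define lift where "lift f b \<longleftrightarrow> b \<in> P.B \<and> \<sigma> (P.\<theta> b) = P.\<theta> f" for f b
  have \<theta>F: "P.\<theta> b \<in> F" if "b \<in> P.B" for b using that by (simp add: P.B_iff)
  have ex_lift: "\<exists>b. lift f b" if f: "f \<in> P.N" for f
  proof -
    have "P.\<theta> f \<in> \<sigma> ` F"
      using \<sigma>'(5) f by (simp add: bij_betw_def residue_field_carrier)
    then obtain k where k: "P.\<theta> f = \<sigma> k" "k \<in> F" by (rule imageE)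
    from subsetD[OF equalityD1[OF P.F_eq] k(2)] obtain b where "k = P.\<theta> b" "b \<in> P.B" by (rule imageE)
    then show ?thesis using k(1) unfolding lift_def by (intro exI[where x = b]) simp
  qed
  have inj: "inj_on \<sigma> F" using \<sigma>'(5) by (simp add: bij_betw_def)
  have val: "\<exists>a. finite_value X y (\<phi> b) a" if "b \<in> P.B" for b
    using Q.B_subset_N[OF \<phi>(1)[OF that]] y unfolding nu_ring_eq by blast
  have val_cong: "a = c" if "lift f b" "lift f d" "finite_value X y (\<phi> b) a" "finite_value X y (\<phi> d) c"
    for f b d a c
  proof -
    have bd: "b \<in> P.B" "d \<in> P.B" using that by (simp_all add: lift_def)
    have "P.\<theta> b = P.\<theta> d"
      by (rule inj_onD[OF inj _ \<theta>F[OF bd(1)] \<theta>F[OF bd(2)]]) (use that in \<open>simp add: lift_def\<close>)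
    then have "(\<lambda>x\<in>topspace X. b x - d x) \<in> P.M"
      using P.\<theta>_eq_iff[OF bd[THEN P.B_subset_N]] by blast
    then have im: "(\<lambda>x\<in>topspace X. \<phi> b x - \<phi> d x) \<in> \<phi> ` P.M"
      unfolding \<phi>_diff[OF bd, symmetric] by (rule imageI)
    obtain e where e: "finite_value X y (\<lambda>x\<in>topspace X. \<phi> b x - \<phi> d x) e"
      using val[OF P.B_diff[OF bd]] unfolding \<phi>_diff[OF bd] by blast
    have "finite_value X y (\<lambda>x\<in>topspace X. (\<lambda>x\<in>topspace X. \<phi> b x - \<phi> d x) x + \<phi> d x) (e + c)"
      by (rule finite_value_add[OF yS e that(4)])
    then have "finite_value X y (\<phi> b) (e + c)"
      by (subst (asm) finite_value_cong[where g = "\<phi> b"]) simp_all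
    then show ?thesis using fixed[OF im e] finite_value_unique[OF yS that(3)] by simp
  qed
  \<comment> \<open>Evaluation at \<open>y\<close> after \<open>\<phi>\<close>, transported to all of \<open>P.N\<close> through that identification.\<close>
  define s where "s f = (THE a. \<exists>b. lift f b \<and> finite_value X y (\<phi> b) a)" for f
  have s_eq: "s f = a" if "lift f b" "finite_value X y (\<phi> b) a" for f b a
    unfolding s_def by (rule the_equality) (use that val_cong in blast)+
  have s_val: "finite_value X y (\<phi> b) (s f)" if l: "lift f b" for f b
  proof -
    have "b \<in> P.B" using l by (simp add: lift_def)
    from val[OF this] obtain a where "finite_value X y (\<phi> b) a" by blast
    then show ?thesis using s_eq[OF l] by simp
  qed
  have "finite_value X p f (s f)" if "f \<in> P.N" for f
  proof (rule real_character_imp_finite_values[OF P.N_algebra P.p _ _ _ _ that])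
    fix f g assume f: "f \<in> P.N" and g: "g \<in> P.N"
    obtain b where b: "lift f b" using ex_lift[OF f] by blast
    obtain c where c: "lift g c" using ex_lift[OF g] by blast
    have bc: "b \<in> P.B" "c \<in> P.B" using b c by (simp_all add: lift_def)
    have "lift (\<lambda>x\<in>topspace X. f x + g x) (\<lambda>x\<in>topspace X. b x + c x)"
      unfolding lift_def P.\<theta>_simps(2)[OF f g, symmetric] P.\<theta>_simps(2)[OF bc[THEN P.B_subset_N], symmetric]
      using \<sigma>'(3)[OF \<theta>F[OF bc(1)] \<theta>F[OF bc(2)]] b c P.B_add[OF bc] by (simp add: lift_def)
    moreover have "finite_value X y (\<phi> (\<lambda>x\<in>topspace X. b x + c x)) (s f + s g)"
      unfolding \<phi>(2)[OF bc] by (rule finite_value_add[OF yS s_val[OF b] s_val[OF c]])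
    ultimately show "s (\<lambda>x\<in>topspace X. f x + g x) = s f + s g" by (rule s_eq)
    have "lift (\<lambda>x\<in>topspace X. f x * g x) (\<lambda>x\<in>topspace X. b x * c x)"
      unfolding lift_def P.\<theta>_simps(1)[OF f g, symmetric] P.\<theta>_simps(1)[OF bc[THEN P.B_subset_N], symmetric]
      using \<sigma>'(2)[OF \<theta>F[OF bc(1)] \<theta>F[OF bc(2)]] b c P.B_mult[OF bc] by (simp add: lift_def)
    moreover have "finite_value X y (\<phi> (\<lambda>x\<in>topspace X. b x * c x)) (s f * s g)"
      unfolding \<phi>(3)[OF bc] by (rule finite_value_mult[OF yS s_val[OF b] s_val[OF c]])
    ultimately show "s (\<lambda>x\<in>topspace X. f x * g x) = s f * s g" by (rule s_eq)
  next
    have "lift (\<lambda>x\<in>topspace X. 1) (\<lambda>x\<in>topspace X. 1)"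
      unfolding lift_def P.\<theta>_simps(3)[symmetric] using \<sigma>'(4) P.B_one by simp
    then show "s (\<lambda>x\<in>topspace X. 1) = 1"
      by (rule s_eq) (simp only: \<phi>(4) finite_value_const[OF yS])
  next
    fix f assume f: "f \<in> P.N" and zero: "s f = 0"
    obtain b where b: "lift f b" using ex_lift[OF f] by blast
    have bB: "b \<in> P.B" using b by (simp add: lift_def)
    have v: "finite_value X y (\<phi> b) 0" using s_val[OF b] zero by simp
    have "b \<in> P.M"
    proof (rule ccontr)
      assume "b \<notin> P.M"
      have "\<phi> b \<notin> \<phi> ` P.M"
      proof
        assume "\<phi> b \<in> \<phi> ` P.M"
        then obtain m where "\<phi> b = \<phi> m" "m \<in> P.M" by (rule imageE)
        then show False using \<phi>(5)[OF bB P.M_subset_B] \<open>b \<notin> P.M\<close> by simp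
      qed
      from image_inverse[OF \<phi>(1)[OF bB] this] obtain c where
        c: "c \<in> Q.B" and im: "(\<lambda>x\<in>topspace X. c x * \<phi> b x - 1) \<in> \<phi> ` P.M" by blast
      obtain a where a: "finite_value X y c a"
        using Q.B_subset_N[OF c] y unfolding nu_ring_eq by blast
      have "finite_value X y (\<lambda>x\<in>topspace X. (\<lambda>x\<in>topspace X. c x * \<phi> b x) x + (\<lambda>x\<in>topspace X. - 1) x)
          (a * 0 + - 1)"
        by (intro finite_value_add finite_value_mult finite_value_const yS a v)
      then have "finite_value X y (\<lambda>x\<in>topspace X. c x * \<phi> b x - 1) (- 1)"
        by (simp cong: restrict_cong)
      from fixed[OF im this] show False by simp
    qed
    then have "P.\<theta> b = P.\<theta> (\<lambda>x\<in>topspace X. 0)"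
      using P.\<theta>_zero_iff[OF P.B_subset_N[OF bB]] P.\<theta>_simps(4) by simp
    moreover have "lift (\<lambda>x\<in>topspace X. 0) (\<lambda>x\<in>topspace X. 0)"
    proof -
      have zB: "(\<lambda>x\<in>topspace X. 0) \<in> P.B"
        using P.B_diff[OF P.B_one P.B_one] by (simp cong: restrict_cong)
      have "\<sigma> \<zero>\<^bsub>P.K\<^esub> = \<zero>\<^bsub>P.K\<^esub>"
        using ring_hom_zero[OF _ ring.subring_is_ring[OF P.K_ring P.F_subring] P.K_ring, of \<sigma>] \<sigma>
        by (simp add: ring_iso_def)
      then show ?thesis unfolding lift_def P.\<theta>_simps(4)[symmetric] using zB by simp
    qed
    ultimately have "P.\<theta> f = \<zero>\<^bsub>P.K\<^esub>" using b by (simp add: lift_def P.\<theta>_simps(4))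
    then show "f \<in> P.M" using P.\<theta>_zero_iff[OF f] by blast
  qed
  then show False using ex_infinite_value[OF P.algebra P.not_real] by blast
qed

text \<open>The ideal \<open>P.M\<close> is distinguished among the maximal ideals of \<open>P.B\<close> without a common zero by having
  more multipliers than the elements of \<open>P.B\<close>. A function \<open>f\<close> outside \<open>P.B\<close>, which exists because \<open>F\<close> is proper, acts on
  \<open>\<phi> ` P.M\<close> as multiplication by some \<open>f'\<close>, and \<open>f'\<close> maps both \<open>\<phi> ` P.M\<close> and \<open>Q.M\<close> into \<open>Q.B\<close>. If
  these ideals were different, they would be comaximal and \<open>f'\<close> would itself lie in \<open>Q.B\<close>; its
  preimage would act on the free ideal \<open>P.M\<close> like \<open>f\<close> and hence be equal to \<open>f\<close>.\<close>

lemma image_max_ideal: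
  assumes \<sigma>: "\<sigma> \<in> ring_iso (P.K\<lparr>carrier := F\<rparr>) P.K" and proper: "F \<noteq> carrier P.K"
  shows "\<phi> ` P.M = Q.M"
proof (rule ccontr)
  assume "\<phi> ` P.M \<noteq> Q.M"
  then obtain g m where gm: "g \<in> \<phi> ` P.M" "m \<in> Q.M" "\<And>x. x \<in> topspace X \<Longrightarrow> g x + m x = 1"
    using comaximal by blast
  obtain f where f: "f \<in> P.N" "f \<notin> P.B"
    using proper subfieldE(3)[OF P.F] unfolding residue_field_carrier P.B_iff by blast
  obtain f' where f': "f' \<in> P.N"
    "\<And>m. m \<in> P.M \<Longrightarrow> \<phi> (\<lambda>x\<in>topspace X. f x * m x) = (\<lambda>x\<in>topspace X. f' x * \<phi> m x)"
    using conductor_multiplier[OF f(1) image_free[OF \<sigma>]] by blast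
  have fm: "(\<lambda>x\<in>topspace X. f x * m x) \<in> P.B" if "m \<in> P.M" for m
    using P.M_subset_B[OF P.M_mult[OF that f(1)]] by (simp only: mult.commute)
  have "(\<lambda>x\<in>topspace X. f' x * g x) \<in> Q.B"
  proof -
    obtain n where n: "g = \<phi> n" "n \<in> P.M" using gm(1) by (rule imageE)
    show ?thesis unfolding n(1) f'(2)[OF n(2), symmetric] by (rule \<phi>(1)[OF fm[OF n(2)]])
  qed
  moreover have "(\<lambda>x\<in>topspace X. m x * f' x) \<in> Q.B"
    by (rule Q.M_subset_B[OF Q.M_mult[OF gm(2) f'(1)]])
  ultimately have "(\<lambda>x\<in>topspace X. (\<lambda>x\<in>topspace X. f' x * g x) x + (\<lambda>x\<in>topspace X. m x * f' x) x) \<in> Q.B"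
    by (rule Q.B_add)
  also have "(\<lambda>x\<in>topspace X. (\<lambda>x\<in>topspace X. f' x * g x) x + (\<lambda>x\<in>topspace X. m x * f' x) x) =
      (\<lambda>x\<in>topspace X. f' x)"
  proof (rule restrict_ext)
    fix x assume x: "x \<in> topspace X"
    have "f' x * g x + m x * f' x = f' x * (g x + m x)" by (simp add: algebra_simps)
    then show "(\<lambda>x\<in>topspace X. f' x * g x) x + (\<lambda>x\<in>topspace X. m x * f' x) x = f' x"
      using gm(3)[OF x] x by simp
  qed
  also have "\<dots> = f'" by (rule P.N_restrict[OF f'(1)])
  finally obtain b where b: "f' = \<phi> b" "b \<in> P.B" using \<phi>(6) by blast
  have "b = f"
  proof (rule free_on_cancel[OF P.algebra _ P.M_free P.N_cont[OF P.B_subset_N[OF b(2)]] P.N_cont[OF f(1)]])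
    show "P.M \<subseteq> P.N" by (rule max_ideal_subset)
    fix m x assume m: "m \<in> P.M" and x: "x \<in> topspace X"
    have "(\<lambda>x\<in>topspace X. b x * m x) = (\<lambda>x\<in>topspace X. f x * m x)"
      by (rule \<phi>(5)[OF P.B_mult[OF b(2) P.M_subset_B[OF m]] fm[OF m]])
        (simp only: f'(2)[OF m] \<phi>(3)[OF b(2) P.M_subset_B[OF m]] b(1))
    from fun_cong[OF this, of x] show "b x * m x = f x * m x" using x by simp
  qed
  then show False using f(2) b(2) by simp
qed

end

context residue_subring_iso
begin

text \<open>Now that the ideals correspond, each \<open>f\<close> in \<open>P.N\<close> is sent to the multiplier \<open>f'\<close> of \<open>Q.M\<close> that
  corresponds to it. Freeness of \<open>Q.M\<close> makes \<open>f'\<close> unique, which yields all ring identities, and the same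
  construction for the inverse of \<open>\<phi>\<close> gives surjectivity.\<close>

lemma extension:
  assumes image: "\<phi> ` P.M = Q.M"
  shows "\<exists>\<Phi>. pointwise_iso X P.N P.N \<Phi> \<and> (\<forall>f\<in>P.B. \<Phi> f = \<phi> f)"
proof -
  let ?\<iota> = "inv_into P.B \<phi>"
  interpret I: residue_subring_iso X A q p F' F ?\<iota> by (rule inverse)
  have "\<forall>f\<in>P.N. \<exists>f'. f' \<in> P.N \<and>
      (\<forall>m\<in>P.M. \<phi> (\<lambda>x\<in>topspace X. f x * m x) = (\<lambda>x\<in>topspace X. f' x * \<phi> m x))"
    using conductor_multiplier Q.M_free unfolding image by blast
  then obtain \<Phi> where \<Phi>: "\<And>f. f \<in> P.N \<Longrightarrow> \<Phi> f \<in> P.N"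
    "\<And>f m. \<lbrakk>f \<in> P.N; m \<in> P.M\<rbrakk> \<Longrightarrow>
       \<phi> (\<lambda>x\<in>topspace X. f x * m x) = (\<lambda>x\<in>topspace X. \<Phi> f x * \<phi> m x)"
    by metis
  have \<phi>M: "\<phi> m \<in> Q.M" if "m \<in> P.M" for m using image that by blast
  have fm: "(\<lambda>x\<in>topspace X. f x * m x) \<in> P.M" if "f \<in> P.N" "m \<in> P.M" for f m
    using P.M_mult[OF that(2,1)] by (simp only: mult.commute)
  have unique: "\<Phi> f = f'" if f: "f \<in> P.N" and f': "f' \<in> P.N"
    and eq: "\<And>m. m \<in> P.M \<Longrightarrow> \<phi> (\<lambda>x\<in>topspace X. f x * m x) = (\<lambda>x\<in>topspace X. f' x * \<phi> m x)"
    for f f'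
  proof (rule free_on_cancel[OF P.algebra max_ideal_subset Q.M_free P.N_cont[OF \<Phi>(1)[OF f]] P.N_cont[OF f']])
    fix m' x assume "m' \<in> Q.M" and x: "x \<in> topspace X"
    then obtain m where m: "m' = \<phi> m" "m \<in> P.M" unfolding image[symmetric] by (auto elim: imageE)
    have "(\<lambda>x\<in>topspace X. \<Phi> f x * \<phi> m x) = (\<lambda>x\<in>topspace X. f' x * \<phi> m x)"
      unfolding \<Phi>(2)[OF f m(2), symmetric] by (rule eq[OF m(2)])
    from fun_cong[OF this, of x] show "\<Phi> f x * m' x = f' x * m' x" using x m(1) by simp
  qed
  have "bij_betw \<Phi> P.N P.N"
    unfolding bij_betw_def
  proof
    show "inj_on \<Phi> P.N"
    proof (rule inj_onI)
      fix f g assume f: "f \<in> P.N" and g: "g \<in> P.N" and eq: "\<Phi> f = \<Phi> g"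
      show "f = g"
      proof (rule free_on_cancel[OF P.algebra max_ideal_subset P.M_free P.N_cont[OF f] P.N_cont[OF g]])
        fix m x assume m: "m \<in> P.M" and x: "x \<in> topspace X"
        have "(\<lambda>x\<in>topspace X. f x * m x) = (\<lambda>x\<in>topspace X. g x * m x)"
          by (rule \<phi>(5)[OF P.M_subset_B[OF fm[OF f m]] P.M_subset_B[OF fm[OF g m]]])
            (simp only: \<Phi>(2)[OF f m] \<Phi>(2)[OF g m] eq)
        from fun_cong[OF this, of x] show "f x * m x = g x * m x" using x by simp
      qed
    qed
    show "\<Phi> ` P.N = P.N"
    proof
      show "\<Phi> ` P.N \<subseteq> P.N" using \<Phi>(1) by (rule image_subsetI)
      show "P.N \<subseteq> \<Phi> ` P.N"
      proof
        fix f' assume f': "f' \<in> P.N"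
        have \<iota>M: "?\<iota> ` Q.M = P.M"
          unfolding image[symmetric] image_image
          using inv_\<phi>[OF P.M_subset_B] by (simp cong: image_cong_simp)
        obtain f where f: "f \<in> P.N"
          "\<And>m'. m' \<in> Q.M \<Longrightarrow> ?\<iota> (\<lambda>x\<in>topspace X. f' x * m' x) = (\<lambda>x\<in>topspace X. f x * ?\<iota> m' x)"
          using I.conductor_multiplier[OF f'] P.M_free unfolding \<iota>M by blast
        have "\<Phi> f = f'"
        proof (rule unique[OF f(1) f'])
          fix m assume m: "m \<in> P.M"
          have "(\<lambda>x\<in>topspace X. \<phi> m x * f' x) \<in> Q.B"
            by (rule Q.M_subset_B[OF Q.M_mult[OF \<phi>M[OF m] f']])
          then have "(\<lambda>x\<in>topspace X. f' x * \<phi> m x) \<in> Q.B" by (simp only: mult.commute)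
          from \<phi>_inv(2)[OF this] show "\<phi> (\<lambda>x\<in>topspace X. f x * m x) = (\<lambda>x\<in>topspace X. f' x * \<phi> m x)"
            unfolding f(2)[OF \<phi>M[OF m]] inv_\<phi>[OF P.M_subset_B[OF m]] .
        qed
        then show "f' \<in> \<Phi> ` P.N" using f(1) by blast
      qed
    qed
  qed
  moreover have "\<Phi> (\<lambda>x\<in>topspace X. 1) = (\<lambda>x\<in>topspace X. 1)"
  proof (rule unique[OF P.N_const P.N_const])
    fix m assume m: "m \<in> P.M"
    have "(\<lambda>x\<in>topspace X. (\<lambda>x\<in>topspace X. 1) x * m x) = m"
      using P.N_restrict[OF P.M_subset_N[OF m]] by (simp cong: restrict_cong)
    moreover have "(\<lambda>x\<in>topspace X. (\<lambda>x\<in>topspace X. 1) x * \<phi> m x) = \<phi> m"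
      using P.N_restrict[OF Q.M_subset_N[OF \<phi>M[OF m]]] by (simp cong: restrict_cong)
    ultimately show "\<phi> (\<lambda>x\<in>topspace X. (\<lambda>x\<in>topspace X. 1) x * m x) =
        (\<lambda>x\<in>topspace X. (\<lambda>x\<in>topspace X. 1) x * \<phi> m x)" by simp
  qed
  moreover have "\<Phi> (\<lambda>x\<in>topspace X. f x + g x) = (\<lambda>x\<in>topspace X. \<Phi> f x + \<Phi> g x)"
    "\<Phi> (\<lambda>x\<in>topspace X. f x * g x) = (\<lambda>x\<in>topspace X. \<Phi> f x * \<Phi> g x)"
    if f: "f \<in> P.N" and g: "g \<in> P.N" for f g
  proof -
    show "\<Phi> (\<lambda>x\<in>topspace X. f x + g x) = (\<lambda>x\<in>topspace X. \<Phi> f x + \<Phi> g x)"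
    proof (rule unique[OF P.N_add[OF f g] P.N_add[OF \<Phi>(1)[OF f] \<Phi>(1)[OF g]]])
      fix m assume m: "m \<in> P.M"
      have "(\<lambda>x\<in>topspace X. (\<lambda>x\<in>topspace X. f x + g x) x * m x) =
          (\<lambda>x\<in>topspace X. (\<lambda>x\<in>topspace X. f x * m x) x + (\<lambda>x\<in>topspace X. g x * m x) x)"
        by (rule restrict_ext) (simp add: distrib_right)
      then have "\<phi> (\<lambda>x\<in>topspace X. (\<lambda>x\<in>topspace X. f x + g x) x * m x) =
          (\<lambda>x\<in>topspace X. (\<lambda>x\<in>topspace X. \<Phi> f x * \<phi> m x) x + (\<lambda>x\<in>topspace X. \<Phi> g x * \<phi> m x) x)"
        by (simp only: \<phi>(2)[OF P.M_subset_B[OF fm[OF f m]] P.M_subset_B[OF fm[OF g m]]]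
            \<Phi>(2)[OF f m] \<Phi>(2)[OF g m])
      also have "\<dots> = (\<lambda>x\<in>topspace X. (\<lambda>x\<in>topspace X. \<Phi> f x + \<Phi> g x) x * \<phi> m x)"
        by (rule restrict_ext) (simp add: distrib_right)
      finally show "\<phi> (\<lambda>x\<in>topspace X. (\<lambda>x\<in>topspace X. f x + g x) x * m x) =
          (\<lambda>x\<in>topspace X. (\<lambda>x\<in>topspace X. \<Phi> f x + \<Phi> g x) x * \<phi> m x)" .
    qed
    show "\<Phi> (\<lambda>x\<in>topspace X. f x * g x) = (\<lambda>x\<in>topspace X. \<Phi> f x * \<Phi> g x)"
    proof (rule unique[OF P.N_mult[OF f g] P.N_mult[OF \<Phi>(1)[OF f] \<Phi>(1)[OF g]]])
      fix m assume m: "m \<in> P.M"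
      have "(\<lambda>x\<in>topspace X. (\<lambda>x\<in>topspace X. f x * g x) x * m x) =
          (\<lambda>x\<in>topspace X. f x * (\<lambda>x\<in>topspace X. g x * m x) x)"
        by (rule restrict_ext) (simp add: mult.assoc)
      then have "\<phi> (\<lambda>x\<in>topspace X. (\<lambda>x\<in>topspace X. f x * g x) x * m x) =
          (\<lambda>x\<in>topspace X. \<Phi> f x * (\<lambda>x\<in>topspace X. \<Phi> g x * \<phi> m x) x)"
        by (simp only: \<Phi>(2)[OF f fm[OF g m]] \<Phi>(2)[OF g m])
      also have "\<dots> = (\<lambda>x\<in>topspace X. (\<lambda>x\<in>topspace X. \<Phi> f x * \<Phi> g x) x * \<phi> m x)"
        by (rule restrict_ext) (simp add: mult.assoc)
      finally show "\<phi> (\<lambda>x\<in>topspace X. (\<lambda>x\<in>topspace X. f x * g x) x * m x) =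
          (\<lambda>x\<in>topspace X. (\<lambda>x\<in>topspace X. \<Phi> f x * \<Phi> g x) x * \<phi> m x)" .
    qed
  qed
  ultimately have "pointwise_iso X P.N P.N \<Phi>"
    unfolding pointwise_iso_def by blast
  moreover have "\<Phi> f = \<phi> f" if f: "f \<in> P.B" for f
    by (rule unique[OF P.B_subset_N[OF f] Q.B_subset_N[OF \<phi>(1)[OF f]]])
      (rule \<phi>(3)[OF f P.M_subset_B])
  ultimately show ?thesis by blast
qed

text \<open>Since \<open>\<phi>\<close> matches the ideals, it matches congruence modulo them.\<close>

lemma residue_iso_induced:
  assumes image: "\<phi> ` P.M = Q.M"
  shows "\<exists>\<psi>\<in>ring_iso (P.K\<lparr>carrier := F\<rparr>) (Q.K\<lparr>carrier := F'\<rparr>).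
    \<forall>f\<in>P.B. \<psi> (theta X A p f) = theta X A q (\<phi> f)"
proof -
  have eq_iff: "Q.\<theta> (\<phi> f) = Q.\<theta> (\<phi> g) \<longleftrightarrow> P.\<theta> f = P.\<theta> g" if f: "f \<in> P.B" and g: "g \<in> P.B" for f g
  proof -
    let ?d = "\<lambda>x\<in>topspace X. f x - g x"
    have d: "?d \<in> P.B" by (rule P.B_diff[OF f g])
    have "?d \<in> P.M \<longleftrightarrow> \<phi> ?d \<in> Q.M"
    proof
      assume "\<phi> ?d \<in> Q.M"
      then obtain m where m: "\<phi> ?d = \<phi> m" "m \<in> P.M" unfolding image[symmetric] by (rule imageE)
      have "?d = m" by (rule \<phi>(5)[OF d P.M_subset_B[OF m(2)] m(1)])
      then show "?d \<in> P.M" using m(2) by simp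
    qed (use image in blast)
    then show ?thesis
      unfolding P.\<theta>_eq_iff[OF P.B_subset_N[OF f] P.B_subset_N[OF g]]
        Q.\<theta>_eq_iff[OF Q.B_subset_N[OF \<phi>(1)[OF f]] Q.B_subset_N[OF \<phi>(1)[OF g]]] \<phi>_diff[OF f g] by simp
  qed
  define \<psi> where "\<psi> k = Q.\<theta> (\<phi> (SOME f. f \<in> P.B \<and> P.\<theta> f = k))" for k
  have \<psi>: "\<psi> (P.\<theta> f) = Q.\<theta> (\<phi> f)" if f: "f \<in> P.B" for f
  proof -
    have "(SOME g. g \<in> P.B \<and> P.\<theta> g = P.\<theta> f) \<in> P.B \<and> P.\<theta> (SOME g. g \<in> P.B \<and> P.\<theta> g = P.\<theta> f) = P.\<theta> f"
      by (rule someI[where x = f]) (simp add: f)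
    then show ?thesis unfolding \<psi>_def using eq_iff[OF _ f] by blast
  qed
  have rep: "\<exists>f\<in>P.B. k = P.\<theta> f" if "k \<in> F" for k
    using subsetD[OF equalityD1[OF P.F_eq] that] by blast
  have mult: "\<psi> (k \<otimes>\<^bsub>P.K\<^esub> l) = \<psi> k \<otimes>\<^bsub>Q.K\<^esub> \<psi> l"
    and add: "\<psi> (k \<oplus>\<^bsub>P.K\<^esub> l) = \<psi> k \<oplus>\<^bsub>Q.K\<^esub> \<psi> l"
    and inj: "\<psi> k = \<psi> l \<Longrightarrow> k = l" if k: "k \<in> F" and l: "l \<in> F" for k l
  proof -
    obtain f where f: "f \<in> P.B" "k = P.\<theta> f" using rep[OF k] by (rule bexE)
    obtain g where g: "g \<in> P.B" "l = P.\<theta> g" using rep[OF l] by (rule bexE)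
    note fN = P.B_subset_N[OF f(1)] P.B_subset_N[OF g(1)]
      and \<phi>N = Q.B_subset_N[OF \<phi>(1)[OF f(1)]] Q.B_subset_N[OF \<phi>(1)[OF g(1)]]
    show "\<psi> (k \<otimes>\<^bsub>P.K\<^esub> l) = \<psi> k \<otimes>\<^bsub>Q.K\<^esub> \<psi> l"
      unfolding f(2) g(2) P.\<theta>_simps(1)[OF fN] \<psi>[OF f(1)] \<psi>[OF g(1)] \<psi>[OF P.B_mult[OF f(1) g(1)]]
        \<phi>(3)[OF f(1) g(1)] Q.\<theta>_simps(1)[OF \<phi>N] ..
    show "\<psi> (k \<oplus>\<^bsub>P.K\<^esub> l) = \<psi> k \<oplus>\<^bsub>Q.K\<^esub> \<psi> l"
      unfolding f(2) g(2) P.\<theta>_simps(2)[OF fN] \<psi>[OF f(1)] \<psi>[OF g(1)] \<psi>[OF P.B_add[OF f(1) g(1)]]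
        \<phi>(2)[OF f(1) g(1)] Q.\<theta>_simps(2)[OF \<phi>N] ..
    show "k = l" if "\<psi> k = \<psi> l"
      using that unfolding f(2) g(2) \<psi>[OF f(1)] \<psi>[OF g(1)] eq_iff[OF f(1) g(1)] .
  qed
  have one: "\<psi> \<one>\<^bsub>P.K\<^esub> = \<one>\<^bsub>Q.K\<^esub>"
    unfolding P.\<theta>_simps(3) Q.\<theta>_simps(3) \<psi>[OF P.B_one] \<phi>(4) ..
  have "\<psi> ` F = \<psi> ` (P.\<theta> ` P.B)" by (rule arg_cong[OF P.F_eq])
  also have "\<dots> = (\<lambda>f. \<psi> (P.\<theta> f)) ` P.B" by (rule image_image)
  also have "\<dots> = (\<lambda>f. Q.\<theta> (\<phi> f)) ` P.B" by (rule image_cong[OF refl \<psi>])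
  also have "\<dots> = Q.\<theta> ` (\<phi> ` P.B)" by (rule image_image[symmetric])
  also have "\<dots> = F'" unfolding \<phi>(6) by (rule Q.F_eq[symmetric])
  finally have bij: "bij_betw \<psi> F F'" unfolding bij_betw_def using inj by (simp add: inj_on_def)
  then have "\<psi> k \<in> F'" if "k \<in> F" for k using that by (rule bij_betwE[rule_format])
  then have "\<psi> \<in> ring_iso (P.K\<lparr>carrier := F\<rparr>) (Q.K\<lparr>carrier := F'\<rparr>)"
    by (intro ring_iso_memI) (simp_all add: mult add one bij)
  then show ?thesis unfolding theta_eq_coset using \<psi> by blast
qed

end

section \<open>Homeomorphisms induced by automorphisms\<close>

text \<open>The transpose of \<open>\<Phi>\<close>, with points regarded as characters. It is meaningful if \<open>\<Phi>\<close> preserves the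
  bounded functions.\<close>

definition pull ::
    "'a topology \<Rightarrow> (('a \<Rightarrow> real) \<Rightarrow> ('a \<Rightarrow> real)) \<Rightarrow> (('a \<Rightarrow> real) \<Rightarrow> real) \<Rightarrow> (('a \<Rightarrow> real) \<Rightarrow> real)"
  where "pull X \<Phi> r = (\<lambda>f\<in>bdd_cont_funs X. r (\<Phi> f))"

text \<open>For each point \<open>x\<close>, the value at \<open>x\<close> of the image of a constant is a ring endomorphism of the
  reals.\<close>

lemma automorphism_const:
  assumes N: "function_algebra X N" and iso: "pointwise_iso X N N \<Phi>"
  shows "\<Phi> (\<lambda>x\<in>topspace X. c) = (\<lambda>x\<in>topspace X. c)"
proof (rule cont_funs_eqI)
  note \<Phi> = pointwise_isoD[OF iso] and const = function_algebraD(5)[OF N]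
  show "\<Phi> (\<lambda>x\<in>topspace X. c) \<in> cont_funs X" "(\<lambda>x\<in>topspace X. c) \<in> cont_funs X"
    by (rule function_algebraD(2)[OF N], rule \<Phi>(1) const, rule const)
      (rule function_algebraD(2)[OF N const])
  fix x assume x: "x \<in> topspace X"
  have "\<Phi> (\<lambda>x\<in>topspace X. c) x = c"
  proof (rule real_endomorphism_id[where \<tau> = "\<lambda>c. \<Phi> (\<lambda>x\<in>topspace X. c) x"])
    show "\<Phi> (\<lambda>x\<in>topspace X. a + b) x = \<Phi> (\<lambda>x\<in>topspace X. a) x + \<Phi> (\<lambda>x\<in>topspace X. b) x" for a b
      using fun_cong[OF \<Phi>(2)[OF const[of a] const[of b]], of x] x by (simp cong: restrict_cong)
    show "\<Phi> (\<lambda>x\<in>topspace X. a * b) x = \<Phi> (\<lambda>x\<in>topspace X. a) x * \<Phi> (\<lambda>x\<in>topspace X. b) x" for a b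
      using fun_cong[OF \<Phi>(3)[OF const[of a] const[of b]], of x] x by (simp cong: restrict_cong)
    show "\<Phi> (\<lambda>x\<in>topspace X. 1) x = 1" unfolding \<Phi>(4) using x by simp
  qed
  then show "\<Phi> (\<lambda>x\<in>topspace X. c) x = (\<lambda>x\<in>topspace X. c) x" using x by simp
qed

text \<open>Boundedness by a constant \<open>n\<close> is algebraic: it means that $n^2 - f^2$ is a square.\<close>

lemma automorphism_bdd:
  assumes N: "function_algebra X N" and iso: "pointwise_iso X N N \<Phi>" and f: "f \<in> bdd_cont_funs X"
  shows "\<Phi> f \<in> bdd_cont_funs X"
proof -
  note \<Phi> = pointwise_isoD[OF iso] and bddN = function_algebraD(1)[OF N]
  obtain n where n: "\<And>x. x \<in> topspace X \<Longrightarrow> \<bar>f x\<bar> \<le> n" using bdd_cont_funs_bound[OF f] by blast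
  \<comment> \<open>The maximum only makes the root continuous on the whole line: on the values of
    \<open>f\<close> its first argument is nonnegative.\<close>
  define k where "k = (\<lambda>x\<in>topspace X. sqrt (max (n\<^sup>2 - (f x)\<^sup>2) 0))"
  have k: "k \<in> bdd_cont_funs X"
    unfolding k_def by (rule bdd_comp[OF _ f]) (intro continuous_intros)
  note ff = bdd_mult[OF f f] and kk = bdd_mult[OF k k]
  have "(\<lambda>x\<in>topspace X. (\<lambda>x\<in>topspace X. f x * f x) x + (\<lambda>x\<in>topspace X. k x * k x) x) =
      (\<lambda>x\<in>topspace X. n\<^sup>2)"
  proof (rule restrict_ext)
    fix x assume x: "x \<in> topspace X"
    have "\<bar>f x\<bar>\<^sup>2 \<le> n\<^sup>2" by (rule power_mono[OF n[OF x]]) simp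
    then show "(\<lambda>x\<in>topspace X. f x * f x) x + (\<lambda>x\<in>topspace X. k x * k x) x = n\<^sup>2"
      using x by (simp add: k_def power2_eq_square)
  qed
  from arg_cong[OF this, of \<Phi>]
  have eq: "(\<lambda>x\<in>topspace X. (\<lambda>x\<in>topspace X. \<Phi> f x * \<Phi> f x) x + (\<lambda>x\<in>topspace X. \<Phi> k x * \<Phi> k x) x) =
      (\<lambda>x\<in>topspace X. n\<^sup>2)"
    unfolding \<Phi>(2)[OF bddN[OF ff] bddN[OF kk]] \<Phi>(3)[OF bddN[OF f] bddN[OF f]]
      \<Phi>(3)[OF bddN[OF k] bddN[OF k]] automorphism_const[OF N iso] .
  have \<Phi>f: "\<Phi> f \<in> cont_funs X" by (rule function_algebraD(2)[OF N \<Phi>(1)[OF bddN[OF f]]])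
  have "(\<lambda>x\<in>topspace X. \<Phi> f x) \<in> bdd_cont_funs X"
  proof (rule restrict_in_bdd_cont_funs[OF cont_funs_continuous[OF \<Phi>f]])
    fix x assume x: "x \<in> topspace X"
    have "(\<Phi> f x)\<^sup>2 + (\<Phi> k x)\<^sup>2 = n\<^sup>2" using fun_cong[OF eq, of x] x by (simp add: power2_eq_square)
    then have "(\<Phi> f x)\<^sup>2 \<le> n\<^sup>2" using zero_le_power2[of "\<Phi> k x"] by linarith
    then show "\<bar>\<Phi> f x\<bar> \<le> \<bar>n\<bar>" by (simp only: abs_le_square_iff)
  qed
  then show ?thesis by (simp only: cont_funs_restrict[OF \<Phi>f])
qed

text \<open>The function $w = 1/(1+f^2)$ is characterized by the equation $w + f^2 w = 1$.\<close>

lemma automorphism_damp: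
  assumes N: "function_algebra X N" and iso: "pointwise_iso X N N \<Phi>" and f: "f \<in> N"
  shows "\<Phi> (damp X f) = damp X (\<Phi> f)" and "\<Phi> (damped X f) = damped X (\<Phi> f)"
proof -
  note \<Phi> = pointwise_isoD[OF iso] and bddN = function_algebraD(1)[OF N]
  have C: "g \<in> cont_funs X" if "g \<in> N" for g by (rule function_algebraD(2)[OF N that])
  have w: "damp X f \<in> N" by (rule bddN[OF damp_bdd[OF C[OF f]]])
  have fw: "(\<lambda>x\<in>topspace X. f x * damp X f x) \<in> N" by (rule function_algebraD(4)[OF N f w])
  have ffw: "(\<lambda>x\<in>topspace X. f x * (\<lambda>x\<in>topspace X. f x * damp X f x) x) \<in> N"
    by (rule function_algebraD(4)[OF N f fw])
  have "(\<lambda>x\<in>topspace X. damp X f x + (\<lambda>x\<in>topspace X. f x * (\<lambda>x\<in>topspace X. f x * damp X f x) x) x) =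
      (\<lambda>x\<in>topspace X. 1)"
  proof (rule restrict_ext)
    fix x assume x: "x \<in> topspace X"
    show "damp X f x + (\<lambda>x\<in>topspace X. f x * (\<lambda>x\<in>topspace X. f x * damp X f x) x) x = 1"
      using one_minus_damp[OF x, of f] damped_eq[OF x, of f] x by (simp add: mult.commute)
  qed
  from arg_cong[OF this, of \<Phi>]
  have eq: "(\<lambda>x\<in>topspace X. \<Phi> (damp X f) x +
      (\<lambda>x\<in>topspace X. \<Phi> f x * (\<lambda>x\<in>topspace X. \<Phi> f x * \<Phi> (damp X f) x) x) x) = (\<lambda>x\<in>topspace X. 1)"
    unfolding \<Phi>(2)[OF w ffw] \<Phi>(3)[OF f fw] \<Phi>(3)[OF f w] \<Phi>(4) .
  show damp: "\<Phi> (damp X f) = damp X (\<Phi> f)"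
  proof (rule cont_funs_eqI)
    show "\<Phi> (damp X f) \<in> cont_funs X" by (rule C[OF \<Phi>(1)[OF w]])
    show "damp X (\<Phi> f) \<in> cont_funs X" using damp_bdd[OF C[OF \<Phi>(1)[OF f]]] bdd_cont_funs_subset by blast
    fix x assume x: "x \<in> topspace X"
    have "\<Phi> (damp X f) x * (1 + (\<Phi> f x)\<^sup>2) = 1"
      using fun_cong[OF eq, of x] x by (simp add: power2_eq_square algebra_simps)
    then have "\<Phi> (damp X f) x = 1 / (1 + (\<Phi> f x)\<^sup>2)" by (rule eq_divide_imp[OF one_plus_square_neq_0])
    then show "\<Phi> (damp X f) x = damp X (\<Phi> f) x" using x by (simp add: damp_def)
  qed
  have product: "damped X g = (\<lambda>x\<in>topspace X. damp X g x * g x)" if g: "g \<in> N" for g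
    by (rule cont_funs_eqI)
      (use damped_bdd[OF C[OF g]] bdd_cont_funs_subset
         C[OF function_algebraD(4)[OF N bddN[OF damp_bdd[OF C[OF g]]] g]] in \<open>auto simp: damped_eq\<close>)
  show "\<Phi> (damped X f) = damped X (\<Phi> f)"
    unfolding product[OF f] product[OF \<Phi>(1)[OF f]] \<Phi>(3)[OF w f] damp ..
qed

lemma pull_in_stone_cech:
  assumes N: "function_algebra X N" and iso: "pointwise_iso X N N \<Phi>"
    and r: "r \<in> topspace (stone_cech X)"
  shows "pull X \<Phi> r \<in> topspace (stone_cech X)"
proof (rule character_in_stone_cech)
  note \<Phi> = pointwise_isoD[OF iso] and bddN = function_algebraD(1)[OF N]
    and bdd = automorphism_bdd[OF N iso]
  show "pull X \<Phi> r \<in> extensional (bdd_cont_funs X)" by (simp add: pull_def)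
  show "pull X \<Phi> r (\<lambda>x\<in>topspace X. 1) = 1"
    by (simp only: pull_def restrict_apply'[OF bdd_const] \<Phi>(4) stone_cech_const[OF r])
  fix f g assume f: "f \<in> bdd_cont_funs X" and g: "g \<in> bdd_cont_funs X"
  show "pull X \<Phi> r (\<lambda>x\<in>topspace X. f x + g x) = pull X \<Phi> r f + pull X \<Phi> r g"
    by (simp only: pull_def restrict_apply'[OF bdd_add[OF f g]] restrict_apply'[OF f] restrict_apply'[OF g]
        \<Phi>(2)[OF bddN[OF f] bddN[OF g]] stone_cech_add[OF bdd[OF f] bdd[OF g] r])
  show "pull X \<Phi> r (\<lambda>x\<in>topspace X. f x * g x) = pull X \<Phi> r f * pull X \<Phi> r g"
    by (simp only: pull_def restrict_apply'[OF bdd_mult[OF f g]] restrict_apply'[OF f] restrict_apply'[OF g]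
        \<Phi>(3)[OF bddN[OF f] bddN[OF g]] stone_cech_mult[OF bdd[OF f] bdd[OF g] r])
qed

text \<open>The topology is that of pointwise convergence on bounded functions, so each coordinate of the
  transpose is again a coordinate function.\<close>

lemma continuous_map_pull:
  assumes N: "function_algebra X N" and iso: "pointwise_iso X N N \<Phi>"
  shows "continuous_map (stone_cech X) (stone_cech X) (pull X \<Phi>)"
proof -
  have "continuous_map (stone_cech X) (product_topology (\<lambda>_. euclideanreal) (bdd_cont_funs X)) (pull X \<Phi>)"
    unfolding continuous_map_componentwise
  proof (intro conjI ballI image_subsetI funcsetI)
    show "pull X \<Phi> r \<in> extensional (bdd_cont_funs X)" for r
      by (simp add: pull_def)
    show "continuous_map (stone_cech X) euclideanreal (\<lambda>r. pull X \<Phi> r f)" if "f \<in> bdd_cont_funs X" for f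
      using continuous_map_stone_cech_coordinate[OF automorphism_bdd[OF N iso that]] that
      by (simp add: pull_def)
  qed
  then have "continuous_map (stone_cech X) (subtopology (product_topology (\<lambda>_. euclideanreal)
      (bdd_cont_funs X)) (topspace (stone_cech X))) (pull X \<Phi>)"
    using pull_in_stone_cech[OF N iso] by (auto simp only: continuous_map_in_subtopology intro!: funcsetI)
  then show ?thesis unfolding stone_cech_eq[symmetric] .
qed

text \<open>Because \<open>\<Phi>\<close> commutes with the passage from \<open>f\<close> to $1/(1+f^2)$ and $f/(1+f^2)$, the extension of
  \<open>f\<close> composed with the transpose is the extension of \<open>\<Phi> f\<close>.\<close>

lemma pull_value_iff:
  assumes N: "function_algebra X N" and iso: "pointwise_iso X N N \<Phi>"
    and r: "r \<in> topspace (stone_cech X)" and f: "f \<in> N"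
  shows "finite_value X (pull X \<Phi> r) f a \<longleftrightarrow> finite_value X r (\<Phi> f) a"
proof -
  have fC: "f \<in> cont_funs X" by (rule function_algebraD(2)[OF N f])
  have \<Phi>fC: "\<Phi> f \<in> cont_funs X"
    by (rule function_algebraD(2)[OF N pointwise_isoD(1)[OF iso f]])
  have "pull X \<Phi> r (damp X f) = r (damp X (\<Phi> f))" "pull X \<Phi> r (damped X f) = r (damped X (\<Phi> f))"
    by (simp_all only: pull_def restrict_apply'[OF damp_bdd[OF fC]]
        restrict_apply'[OF damped_bdd[OF fC]] automorphism_damp[OF N iso f])
  then show ?thesis
    by (simp only: finite_value_iff[OF fC pull_in_stone_cech[OF N iso r]] finite_value_iff[OF \<Phi>fC r])
qed

lemma pull_inverse:
  assumes N: "function_algebra X N" and iso: "pointwise_iso X N N \<Psi>"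
    and inv: "\<And>f. f \<in> N \<Longrightarrow> \<Phi> (\<Psi> f) = f" and r: "r \<in> topspace (stone_cech X)"
  shows "pull X \<Psi> (pull X \<Phi> r) = r"
proof (rule extensionalityI[OF _ stone_cech_extensional[OF r]])
  show "pull X \<Psi> (pull X \<Phi> r) \<in> extensional (bdd_cont_funs X)" by (simp add: pull_def)
  show "pull X \<Psi> (pull X \<Phi> r) f = r f" if f: "f \<in> bdd_cont_funs X" for f
    by (simp only: pull_def restrict_apply'[OF f] restrict_apply'[OF automorphism_bdd[OF N iso f]]
        inv[OF function_algebraD(1)[OF N f]])
qed

section \<open>Isomorphic subrings induce homeomorphisms\<close>

theorem theorem3p1:
  fixes X :: "'a topology"
    and A :: "('a \<Rightarrow> real) set"
    and p q :: "('a \<Rightarrow> real) \<Rightarrow> real"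
    and F F' :: "('a \<Rightarrow> real) set set"
  assumes "tychonoff_space X"
    and "intermediate_ring X A"
    and "p \<in> topspace (stone_cech X) - real_points X A"
    and "q \<in> topspace (stone_cech X) - real_points X A"
    and "proper_copy F (residue_field X (nu_ring X A) p)"
    and "proper_copy F' (residue_field X (nu_ring X A) q)"
    and "fun_ring X (B_ring X A p F) \<simeq> fun_ring X (B_ring X A q F')"
  shows "\<exists>h. homeomorphic_map (stone_cech X) (stone_cech X) h \<and> h p = q \<and>
             induces_iso X A p q F F' h"
proof -
  have A: "function_algebra X A" by (rule intermediate_ring_imp_function_algebra[OF assms(2)])
  obtain \<phi> where "pointwise_iso X (B_ring X A p F) (B_ring X A q F') \<phi>"
    using assms(7) unfolding is_ring_iso_def pointwise_iso_iff_ring_iso by blast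
  then have "residue_subring_iso X A p q F F' \<phi>"
    using A assms(3-6)
    by (intro residue_subring_iso.intro residue_subring.intro residue_subring_iso_axioms.intro)
      (simp_all add: proper_copy_def)
  then interpret residue_subring_iso X A p q F F' \<phi> .
  obtain \<sigma> where \<sigma>: "\<sigma> \<in> ring_iso (P.K\<lparr>carrier := F\<rparr>) P.K"
    using assms(5) by (auto simp: proper_copy_def is_ring_iso_def)
  have image: "\<phi> ` P.M = Q.M"
    using image_max_ideal[OF \<sigma>] assms(5) by (simp add: proper_copy_def)
  obtain \<Phi> where \<Phi>_iso: "pointwise_iso X P.N P.N \<Phi>" and \<Phi>\<phi>: "\<And>f. f \<in> P.B \<Longrightarrow> \<Phi> f = \<phi> f"
    using extension[OF image] by blast
  define \<Psi> where "\<Psi> = inv_into P.N \<Phi>"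
  have \<Psi>_iso: "pointwise_iso X P.N P.N \<Psi>"
    unfolding \<Psi>_def by (rule pointwise_iso_inverse[OF \<Phi>_iso P.N_add P.N_mult P.N_const])
  note \<Phi> = pointwise_isoD[OF \<Phi>_iso]
  have \<Phi>\<Psi>: "\<Phi> (\<Psi> f) = f" if "f \<in> P.N" for f
    using that \<Phi>(6) by (simp add: \<Psi>_def f_inv_into_f)
  have \<Psi>\<Phi>: "\<Psi> (\<Phi> f) = f" if "f \<in> P.N" for f
    using that \<Phi>(5) unfolding \<Psi>_def by (intro inv_into_f_f inj_onI) auto
  let ?S = "stone_cech X" and ?h = "pull X \<Psi>" and ?k = "inv_into (topspace (stone_cech X)) (pull X \<Psi>)"
  have hk: "?h (pull X \<Phi> r) = r" if "r \<in> topspace ?S" for r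
    by (rule pull_inverse[OF P.N_algebra \<Psi>_iso \<Phi>\<Psi> that])
  have kh: "pull X \<Phi> (?h r) = r" if "r \<in> topspace ?S" for r
    by (rule pull_inverse[OF P.N_algebra \<Phi>_iso \<Psi>\<Phi> that])
  have "homeomorphic_maps ?S ?S ?h (pull X \<Phi>)"
    unfolding homeomorphic_maps_def
    using continuous_map_pull[OF P.N_algebra \<Psi>_iso] continuous_map_pull[OF P.N_algebra \<Phi>_iso] hk kh
    by blast
  then have homeo: "homeomorphic_map ?S ?S ?h" by (rule homeomorphic_maps_imp_map)
  have inj: "inj_on ?h (topspace ?S)" by (rule inj_on_inverseI[where g = "pull X \<Phi>"]) (rule kh)
  have k_eq: "?k r = pull X \<Phi> r" if r: "r \<in> topspace ?S" for r
  proof (rule inv_into_f_eq)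
    show "inj_on ?h (topspace ?S)" by (rule inj)
    show "pull X \<Phi> r \<in> topspace ?S" by (rule pull_in_stone_cech[OF P.N_algebra \<Phi>_iso r])
    show "?h (pull X \<Phi> r) = r" by (rule hk[OF r])
  qed
  \<comment> \<open>Otherwise a bounded member \<open>g\<close> of \<open>Q.M\<close> would not vanish at \<open>?h p\<close>; but
     \<open>\<Psi> g\<close> lies in \<open>P.M\<close>, so it vanishes at \<open>p\<close>.\<close>
  have "?h p = q"
  proof (rule ccontr)
    assume "?h p \<noteq> q"
    from max_ideal_separates[OF Q.N_algebra Q.p pull_in_stone_cech[OF P.N_algebra \<Psi>_iso P.p] this]
    obtain g where g: "g \<in> bdd_cont_funs X" "g \<in> Q.M" "?h p g \<noteq> 0" by blast
    obtain m where m: "g = \<phi> m" "m \<in> P.M" using g(2) unfolding image[symmetric] by (rule imageE)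
    have "\<Psi> g = m"
      using \<Psi>\<Phi>[OF P.M_subset_N[OF m(2)]] \<Phi>\<phi>[OF P.M_subset_B[OF m(2)]] m(1) by simp
    then have "finite_value X p (\<Psi> g) 0" using max_ideal_value_zero[OF P.N_algebra P.p m(2)] by simp
    then have "p (\<Psi> g) = 0"
      using finite_value_bdd_eq[OF P.p automorphism_bdd[OF P.N_algebra \<Psi>_iso g(1)]] by fastforce
    then show False using g(1,3) by (simp add: pull_def)
  qed
  moreover have "induces_iso X A p q F F' ?h"
  proof -
    have ext: "sc_ext X f (?k (sc_embed X x)) = Some (\<phi> f x)" if f: "f \<in> P.B" and x: "x \<in> topspace X" for f x
    proof -
      note e = sc_embed_in_stone_cech[OF x] and fN = P.B_subset_N[OF f]
      have "finite_value X (sc_embed X x) (\<Phi> f) (\<Phi> f x)"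
        by (rule finite_value_embed[OF P.N_cont[OF \<Phi>(1)[OF fN]] x])
      then have "finite_value X (pull X \<Phi> (sc_embed X x)) f (\<Phi> f x)"
        by (simp only: pull_value_iff[OF P.N_algebra \<Phi>_iso e fN])
      then show ?thesis
        unfolding k_eq[OF e] \<Phi>\<phi>[OF f]
        using sc_ext_eq_Some_iff[OF P.N_cont[OF fN] pull_in_stone_cech[OF P.N_algebra \<Phi>_iso e]] by blast
    qed
    have transport: "transport X ?k f = \<phi> f" if f: "f \<in> P.B" for f
    proof -
      have "transport X ?k f = (\<lambda>x\<in>topspace X. \<phi> f x)"
        unfolding transport_def by (rule restrict_ext) (simp add: ext[OF f])
      then show ?thesis using P.N_restrict[OF Q.B_subset_N[OF \<phi>(1)[OF f]]] by simp
    qed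
    have "real_transport X ?k f \<and> transport X ?k f \<in> Q.B" if f: "f \<in> P.B" for f
      using ext[OF f] \<phi>(1)[OF f] by (simp add: real_transport_def transport[OF f])
    then show ?thesis
      using residue_iso_induced[OF image] transport
      unfolding induces_iso_def Let_def by (metis (no_types, lifting))
  qed
  ultimately show ?thesis using homeo by blast
qed

end
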